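(* Let $G$ be a connected simple split algebraic group of adjoint type over a non-archimedean local field, $\Gamma$ a torsion-free finite-index subgroup of $W_{\mathrm{aff}}$, and $\pi$ an irreducible representation of the complex dual group $\hat G(\mathbb C)$ whose nontrivial weights form the Weyl group orbit of a fundamental weight. When $|u|<1$, $$L(\Gamma\backslash W_{\mathrm{ext}},\pi,u)=(1-u)^{-\epsilon(\pi)N}\exp\Bigl(\sum_{n=1}^\infty\frac{N_n}{n}u^n\Bigr),$$ where $\epsilon(\pi)=|\mathrm{wt}(\pi)\smallsetminus\mathrm{wt}'(\pi)|$ is the multiplicity of the trivial weight in $\mathrm{wt}(\pi)$, and $N$ is the cardinality of $\Gamma\backslash W_{\mathrm{ext}}/W$.
   Context: Let $T$ be a maximal split torus of $G$ with character group $X(T)$, cocharacter group $Y(T)$, roots $\Phi\subset X(T)$ and Weyl group $W$. $V=Y(T)\otimes\mathbb R$ carries a $W$-invariant inner product. The coweight lattice is $\Lambda=\{\lambda\in V:\langle\alpha,\lambda\rangle\in\mathbb Z\ \forall\alpha\in\Phi\}$; since $G$ is adjoint, $\Lambda=Y(T)$. $\Lambda_r\subset\Lambda$ is the coroot lattice. $W_{\mathrm{ext}}=\Lambda\rtimes W$ and $W_{\mathrm{aff}}=\Lambda_r\rtimes W$ act on $V$ by isometries, lattice elements acting by translation. The apartment $\mathcal A$ is $V$ with the simplicial structure given by the walls $\{v:\langle\alpha,v\rangle=k\}$, $\alpha\in\Phi$, $k\in\mathbb Z$. $\Lambda\cong W_{\mathrm{ext}}/W$ is the set of hyper-special vertices,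 and $\mathcal A_\Gamma=\Gamma\backslash\mathcal A$ is a finite complex. Weights of $\hat G(\mathbb C)$ are identified with elements of $Y(T)=\Lambda$. $\mathrm{wt}(\pi)$ is the multiset of weights of $\pi$ (with multiplicity) and $\mathrm{wt}'(\pi)$ the nontrivial ones, which all have the same length. **$L$-function.** An irreducible representation $\rho$ of $W_{\mathrm{ext}}$ is unramified if it has a nonzero $W$-fixed vector; then it is the unique unramified subrepresentation of $\mathrm{Ind}_\Lambda^{W_{\mathrm{ext}}}\chi_\rho$ for a character $\chi_\rho$ of $\Lambda$, unique up to $W$. With $\mathrm{Irr}^{\mathrm{unr}}(\Gamma\backslash W_{\mathrm{ext}})$ the multiset of irreducible unramified subrepresentations of $L^2(\Gamma\backslash W_{\mathrm{ext}})$ (with multiplicity), $$L(\Gamma\backslash W_{\mathrm{ext}},\pi,u)=\prod_{\rho\in\mathrm{Irr}^{\mathrm{unr}}(\Gamma\backslash W_{\mathrm{ext}})}\ \prod_{\lambda\in\mathrm{wt}(\pi)}(1-\chi_\rho(\lambda)u)^{-1}.$$ **The numbers $N_n$.** $N_n$ is the number of closed walks (with starting point a hyper-special vertex) contained in the 1-skeleton of $\mathcal A_\Gamma$ which lift to a part of an oriented straight line in $\mathcal A$ having the direction of some $\lambda\in\mathrm{wt}'(\pi)$, and whose length is $n$ times the length of the elements of $\mathrm{wt}'(\pi)$; equivalently $$N_n=\sum_{\lambda\in\mathrm{wt}'(\pi)}\sum_{\gamma\in\Gamma}\#\{x\in\Gamma\backslash\Lambda:\gamma(x)=x+n\lambda\},$$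 where $\Gamma\backslash\Lambda$ denotes a fixed set of representatives in $\Lambda$. (No condition is imposed that the walk be straight where it closes up.) *)

theory Defs
  imports
    "HOL-Analysis.Analysis"
    "HOL-Algebra.Coset"
    "HOL-Algebra.Algebraic_Closure_Type"
    "HOL-Computational_Algebra.Group_Closure"
    "HOL-Library.Multiset"
begin

section \<open>Linear algebraic groups\<close>

text \<open>
  Linear algebraic groups over an algebraically closed field \<open>K\<close> are Zariski closed subgroups of
  \<open>GL\<^sub>n(K)\<close>, where \<open>n\<close> is the size of a finite index type. An \<open>F\<close>-structure, for a subfield \<open>F\<close>
  of \<open>K\<close>, is treated in the classical way, by requiring that vanishing ideals are spanned by
  polynomials with coefficients in \<open>F\<close>. As \<open>K\<close> is infinite, polynomials in the matrix entries are
  identified with the functions they define.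
\<close>

inductive_set polys :: "'k::field set \<Rightarrow> ('k^'n^'n \<Rightarrow> 'k) set" for F :: "'k set" where
  const: "c \<in> F \<Longrightarrow> (\<lambda>_. c) \<in> polys F"
| entry: "(\<lambda>A. A $ i $ j) \<in> polys F"
| add: "p \<in> polys F \<Longrightarrow> q \<in> polys F \<Longrightarrow> (\<lambda>A. p A + q A) \<in> polys F"
| mult: "p \<in> polys F \<Longrightarrow> q \<in> polys F \<Longrightarrow> (\<lambda>A. p A * q A) \<in> polys F"

definition GL :: "('k::field^'n^'n) monoid" where
  "GL = \<lparr>carrier = {A. invertible A}, monoid.mult = (**), one = mat 1\<rparr>"

abbreviation as_group :: "('k::field^'n^'n) set \<Rightarrow> ('k^'n^'n) monoid" where
  "as_group G \<equiv> GL\<lparr>carrier := G\<rparr>"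

definition zariski_closed :: "('k::field^'n^'n) set \<Rightarrow> bool" where
  "zariski_closed S \<longleftrightarrow>
     (\<exists>P \<subseteq> polys UNIV. S = {A. invertible A \<and> (\<forall>p\<in>P. p A = 0)})"

definition zariski_connected :: "('k::field^'n^'n) set \<Rightarrow> bool" where
  "zariski_connected S \<longleftrightarrow>
     \<not> (\<exists>A B. zariski_closed A \<and> zariski_closed B \<and> A \<noteq> {} \<and> B \<noteq> {} \<and> A \<inter> B = {} \<and> A \<union> B = S)"

definition closed_subgroup :: "('k::field^'n^'n) set \<Rightarrow> bool" where
  "closed_subgroup G \<longleftrightarrow> subgroup G GL \<and> zariski_closed G"

definition regular_on :: "'k::field set \<Rightarrow> ('k^'n^'n) set \<Rightarrow> ('k^'n^'n \<Rightarrow> 'k) \<Rightarrow> bool" where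
  "regular_on F S f \<longleftrightarrow> (\<exists>p\<in>polys F. \<exists>r::nat. \<forall>A\<in>S. f A = p A / det A ^ r)"

definition defined_over :: "'k::field set \<Rightarrow> ('k^'n^'n) set \<Rightarrow> bool" where
  "defined_over F S \<longleftrightarrow>
     (\<forall>p\<in>polys UNIV. (\<forall>A\<in>S. p A = 0) \<longrightarrow>
        (\<exists>(m::nat) c q. (\<forall>i<m. q i \<in> polys F \<and> (\<forall>A\<in>S. q i A = 0)) \<and>
           p = (\<lambda>A. \<Sum>i<m. c i * q i A)))"

definition unipotent :: "'k::field^'n^'n \<Rightarrow> bool" where
  "unipotent A \<longleftrightarrow> (\<exists>k. (((**) (A - mat 1)) ^^ k) (mat 1) = 0)"

definition reductive_group :: "('k::field^'n^'n) set \<Rightarrow> bool" where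
  "reductive_group G \<longleftrightarrow> closed_subgroup G \<and> zariski_connected G \<and>
     (\<forall>U. closed_subgroup U \<and> zariski_connected U \<and> U \<lhd> as_group G \<and> (\<forall>A\<in>U. unipotent A)
        \<longrightarrow> U = {mat 1})"

definition simple_algebraic_group :: "('k::field^'n^'n) set \<Rightarrow> bool" where
  "simple_algebraic_group G \<longleftrightarrow> closed_subgroup G \<and> zariski_connected G \<and>
     (\<exists>A\<in>G. \<exists>B\<in>G. A ** B \<noteq> B ** A) \<and>
     (\<forall>U. closed_subgroup U \<and> zariski_connected U \<and> U \<lhd> as_group G \<longrightarrow> U = {mat 1} \<or> U = G)"

definition alg_torus :: "('k::field^'n^'n) set \<Rightarrow> bool" where
  "alg_torus T \<longleftrightarrow> closed_subgroup T \<and> zariski_connected T \<and>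
     (\<exists>P::'k^'n^'n. invertible P \<and> (\<forall>t\<in>T. \<forall>i j. i \<noteq> j \<longrightarrow> (P ** t ** matrix_inv P) $ i $ j = 0))"

definition maximal_torus :: "('k::field^'n^'n) set \<Rightarrow> ('k^'n^'n) set \<Rightarrow> bool" where
  "maximal_torus G T \<longleftrightarrow> alg_torus T \<and> T \<subseteq> G \<and> (\<forall>S. alg_torus S \<and> T \<subseteq> S \<and> S \<subseteq> G \<longrightarrow> S = T)"

text \<open>A character is represented by a function on all matrices; only its values on \<open>T\<close> matter.\<close>

definition characters :: "('k::field^'n^'n) set \<Rightarrow> ('k^'n^'n \<Rightarrow> 'k) set" where
  "characters T = {f. regular_on UNIV T f \<and> (\<forall>t\<in>T. f t \<noteq> 0) \<and>
     (\<forall>s\<in>T. \<forall>t\<in>T. f (s ** t) = f s * f t)}"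

definition split_torus :: "'k::field set \<Rightarrow> ('k^'n^'n) set \<Rightarrow> bool" where
  "split_torus F T \<longleftrightarrow> alg_torus T \<and> defined_over F T \<and> (\<forall>f\<in>characters T. regular_on F T f)"

definition mat_scale :: "'k::field \<Rightarrow> 'k^'n^'n \<Rightarrow> 'k^'n^'n" where
  "mat_scale c A = (\<chi> i j. c * A $ i $ j)"

text \<open>
  The Lie algebra is the Zariski tangent space at the identity: the polynomial \<open>q\<close> below is
  \<open>p\<close> restricted to the line \<open>1 + t Z\<close>, and its linear coefficient is the derivative of \<open>p\<close> at the
  identity in direction \<open>Z\<close>.
\<close>

definition lie_algebra :: "('k::field^'n^'n) set \<Rightarrow> ('k^'n^'n) set" where
  "lie_algebra G = {Z. \<forall>p\<in>polys UNIV. (\<forall>A\<in>G. p A = 0) \<longrightarrow>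
     (\<forall>q. (\<forall>t. poly q t = p (mat 1 + mat_scale t Z)) \<longrightarrow> Polynomial.coeff q 1 = 0)}"


section \<open>Root systems\<close>

text \<open>
  \<open>V = Y(T) \<otimes> \<real>\<close> is a Euclidean space whose inner product is the chosen Weyl group invariant one.
  It is used to identify \<open>V\<close> with its dual, so roots are vectors of \<open>V\<close> as well, the
  pairing \<open>\<langle>\<alpha>, \<lambda>\<rangle>\<close> is \<open>\<alpha> \<bullet> \<lambda>\<close>, the coroot of \<open>\<alpha>\<close> becomes \<open>2 \<alpha> / (\<alpha> \<bullet> \<alpha>)\<close>, and the coroot of
  the coroot of \<open>\<alpha>\<close> is \<open>\<alpha>\<close>.
\<close>

definition coroot :: "'a::euclidean_space \<Rightarrow> 'a" where
  "coroot \<alpha> = (2 / (\<alpha> \<bullet> \<alpha>)) *\<^sub>R \<alpha>"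

definition refl :: "'a::euclidean_space \<Rightarrow> 'a \<Rightarrow> 'a" where
  "refl \<alpha> v = v - (\<alpha> \<bullet> v) *\<^sub>R coroot \<alpha>"

definition root_system :: "'a::euclidean_space set \<Rightarrow> bool" where
  "root_system \<Phi> \<longleftrightarrow> finite \<Phi> \<and> 0 \<notin> \<Phi> \<and> span \<Phi> = UNIV \<and>
     (\<forall>\<alpha>\<in>\<Phi>. refl \<alpha> ` \<Phi> = \<Phi>) \<and>
     (\<forall>\<alpha>\<in>\<Phi>. \<forall>\<beta>\<in>\<Phi>. \<beta> \<bullet> coroot \<alpha> \<in> \<int>) \<and>
     (\<forall>\<alpha>\<in>\<Phi>. \<forall>c. c *\<^sub>R \<alpha> \<in> \<Phi> \<longrightarrow> c = 1 \<or> c = -1)"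

inductive_set weyl :: "'a::euclidean_space set \<Rightarrow> ('a \<Rightarrow> 'a) set" for \<Phi> :: "'a set" where
  id: "id \<in> weyl \<Phi>"
| refl: "\<alpha> \<in> \<Phi> \<Longrightarrow> w \<in> weyl \<Phi> \<Longrightarrow> refl \<alpha> \<circ> w \<in> weyl \<Phi>"

definition coweight_lattice :: "'a::euclidean_space set \<Rightarrow> 'a set" where
  "coweight_lattice \<Phi> = {l. \<forall>\<alpha>\<in>\<Phi>. \<alpha> \<bullet> l \<in> \<int>}"

definition coroot_lattice :: "'a::euclidean_space set \<Rightarrow> 'a set" where
  "coroot_lattice \<Phi> = group_closure (coroot ` \<Phi>)"

definition simple_system :: "'a::euclidean_space set \<Rightarrow> 'a set \<Rightarrow> bool" where
  "simple_system \<Phi> \<Delta> \<longleftrightarrow> \<Delta> \<subseteq> \<Phi> \<and> independent \<Delta> \<and>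
     (\<forall>\<beta>\<in>\<Phi>. \<exists>c::'a \<Rightarrow> nat.
        \<beta> = (\<Sum>\<alpha>\<in>\<Delta>. real (c \<alpha>) *\<^sub>R \<alpha>) \<or> \<beta> = - (\<Sum>\<alpha>\<in>\<Delta>. real (c \<alpha>) *\<^sub>R \<alpha>))"

text \<open>
  The simple coroots of the dual group are the simple roots of \<open>G\<close>, so its fundamental weights form
  the basis of \<open>V\<close> dual to a system of simple roots of \<open>\<Phi>\<close>.
\<close>

definition dual_fundamental_weight :: "'a::euclidean_space set \<Rightarrow> 'a \<Rightarrow> bool" where
  "dual_fundamental_weight \<Phi> \<omega> \<longleftrightarrow>
     (\<exists>\<Delta>. simple_system \<Phi> \<Delta> \<and> (\<exists>\<alpha>\<in>\<Delta>. \<alpha> \<bullet> \<omega> = 1 \<and> (\<forall>\<beta>\<in>\<Delta> - {\<alpha>}. \<beta> \<bullet> \<omega> = 0)))"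

definition ext_affine_weyl :: "'a::euclidean_space set \<Rightarrow> ('a \<Rightarrow> 'a) set" where
  "ext_affine_weyl \<Phi> = {(\<lambda>v. w v + l) | w l. w \<in> weyl \<Phi> \<and> l \<in> coweight_lattice \<Phi>}"

definition affine_weyl :: "'a::euclidean_space set \<Rightarrow> ('a \<Rightarrow> 'a) set" where
  "affine_weyl \<Phi> = {(\<lambda>v. w v + l) | w l. w \<in> weyl \<Phi> \<and> l \<in> coroot_lattice \<Phi>}"

definition comp_group :: "('a \<Rightarrow> 'a) set \<Rightarrow> ('a \<Rightarrow> 'a) monoid" where
  "comp_group S = \<lparr>carrier = S, monoid.mult = (\<circ>), one = id\<rparr>"

definition torsion_free :: "('a \<Rightarrow> 'a) set \<Rightarrow> bool" where
  "torsion_free \<Gamma> \<longleftrightarrow> (\<forall>\<gamma>\<in>\<Gamma>. \<forall>n>0. \<gamma> ^^ n = id \<longrightarrow> \<gamma> = id)"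

definition finite_index :: "('g, 'b) monoid_scheme \<Rightarrow> 'g set \<Rightarrow> bool" where
  "finite_index G H \<longleftrightarrow> finite (rcosets\<^bsub>G\<^esub> H)"


section \<open>The root datum of a reductive group\<close>

definition upper :: "'k::field \<Rightarrow> 'k^2^2" where
  "upper c = vector [vector [1, c], vector [0, 1]]"

definition lower :: "'k::field \<Rightarrow> 'k^2^2" where
  "lower c = vector [vector [1, 0], vector [c, 1]]"

definition diag :: "'k::field \<Rightarrow> 'k^2^2" where
  "diag z = vector [vector [z, 0], vector [0, inverse z]]"

text \<open>
  The reductive group \<open>G\<close> with maximal torus \<open>T\<close> has character lattice \<open>L\<close>, identified with \<open>X(T)\<close>
  by \<open>ch\<close>, its roots are \<open>R\<close>, and the coroot of \<open>a \<in> R\<close>, as a functional on \<open>L\<close>, is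
  \<open>x \<mapsto> x \<bullet> coroot a\<close>. The latter is expressed by the homomorphism from \<open>SL\<^sub>2\<close> attached to \<open>a\<close>, which
  maps the unipotent triangular matrices to the root subgroups of \<open>a\<close> and \<open>-a\<close>, and whose
  restriction to the diagonal is the coroot.
\<close>

definition coroot_hom ::
  "('k::field^'n^'n) set \<Rightarrow> ('k^'n^'n) set \<Rightarrow> 'a::euclidean_space set \<Rightarrow> ('a \<Rightarrow> 'k^'n^'n \<Rightarrow> 'k) \<Rightarrow>
   'a \<Rightarrow> ('k^2^2 \<Rightarrow> 'k^'n^'n) \<Rightarrow> bool" where
  "coroot_hom G T L ch a \<phi> \<longleftrightarrow>
     \<phi> \<in> hom (as_group {A. det A = 1}) (as_group G) \<and>
     (\<forall>i j. regular_on UNIV {A. det A = 1} (\<lambda>A. \<phi> A $ i $ j)) \<and>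
     (\<forall>t\<in>T. \<forall>c. t ** \<phi> (upper c) ** matrix_inv t = \<phi> (upper (ch a t * c)) \<and>
                 t ** \<phi> (lower c) ** matrix_inv t = \<phi> (lower (inverse (ch a t) * c))) \<and>
     (\<forall>z. z \<noteq> 0 \<longrightarrow> \<phi> (diag z) \<in> T \<and>
        (\<forall>x\<in>L. x \<bullet> coroot a \<in> \<int> \<and> ch x (\<phi> (diag z)) = z powi \<lfloor>x \<bullet> coroot a\<rfloor>))"

definition has_root_datum ::
  "('k::field^'n^'n) set \<Rightarrow> ('k^'n^'n) set \<Rightarrow> ('a::euclidean_space \<Rightarrow> 'k^'n^'n \<Rightarrow> 'k) \<Rightarrow>
   'a set \<Rightarrow> 'a set \<Rightarrow> bool" where
  "has_root_datum G T ch L R \<longleftrightarrow>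
     reductive_group G \<and> maximal_torus G T \<and>
     (\<forall>x\<in>L. ch x \<in> characters T) \<and>
     (\<forall>x\<in>L. \<forall>y\<in>L. x + y \<in> L \<and> - x \<in> L \<and> (\<forall>t\<in>T. ch (x + y) t = ch x t * ch y t)) \<and>
     (\<forall>x\<in>L. (\<forall>t\<in>T. ch x t = 1) \<longrightarrow> x = 0) \<and>
     (\<forall>f\<in>characters T. \<exists>x\<in>L. \<forall>t\<in>T. f t = ch x t) \<and>
     R = {a\<in>L. a \<noteq> 0 \<and>
       (\<exists>Z\<in>lie_algebra G. Z \<noteq> 0 \<and> (\<forall>t\<in>T. t ** Z ** matrix_inv t = mat_scale (ch a t) Z))} \<and>
     (\<forall>a\<in>R. \<exists>\<phi>. coroot_hom G T L ch a \<phi>)"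

text \<open>
  For \<open>G\<close> of adjoint type the character lattice is the root lattice and the cocharacter lattice is
  the coweight lattice; the dual group exchanges the two lattices, and roots with coroots.
\<close>

definition adjoint_group ::
  "('k::field^'n^'n) set \<Rightarrow> ('k^'n^'n) set \<Rightarrow> ('a::euclidean_space \<Rightarrow> 'k^'n^'n \<Rightarrow> 'k) \<Rightarrow>
   'a set \<Rightarrow> bool" where
  "adjoint_group G T ch \<Phi> \<longleftrightarrow> has_root_datum G T ch (group_closure \<Phi>) \<Phi>"

definition dual_group ::
  "(complex^'n^'n) set \<Rightarrow> (complex^'n^'n) set \<Rightarrow>
   ('a::euclidean_space \<Rightarrow> complex^'n^'n \<Rightarrow> complex) \<Rightarrow> 'a set \<Rightarrow> bool" where
  "dual_group G T ch \<Phi> \<longleftrightarrow> has_root_datum G T ch (coweight_lattice \<Phi>) (coroot ` \<Phi>)"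

text \<open>The last clause says that the closed unit ball, hence the topology of \<open>F\<close>, is (locally) compact.\<close>

definition nonarch_local_field :: "('f::field \<Rightarrow> real) \<Rightarrow> bool" where
  "nonarch_local_field v \<longleftrightarrow>
     (\<forall>x. 0 \<le> v x) \<and> (\<forall>x. v x = 0 \<longleftrightarrow> x = 0) \<and>
     (\<forall>x y. v (x * y) = v x * v y) \<and> (\<forall>x y. v (x + y) \<le> max (v x) (v y)) \<and>
     (\<exists>x. x \<noteq> 0 \<and> v x \<noteq> 1) \<and>
     (\<forall>s::nat \<Rightarrow> 'f. (\<forall>n. v (s n) \<le> 1) \<longrightarrow>
        (\<exists>l r. strict_mono r \<and> (\<lambda>n. v (s (r n) - l)) \<longlonglongrightarrow> 0))"

definition split_adjoint_simple_group ::
  "('f::field alg_closure^'n^'n) set \<Rightarrow> ('f alg_closure^'n^'n) set \<Rightarrow>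
   ('a::euclidean_space \<Rightarrow> 'f alg_closure^'n^'n \<Rightarrow> 'f alg_closure) \<Rightarrow> 'a set \<Rightarrow> bool" where
  "split_adjoint_simple_group G T ch \<Phi> \<longleftrightarrow>
     simple_algebraic_group G \<and> defined_over (range to_ac) G \<and> split_torus (range to_ac) T \<and>
     adjoint_group G T ch \<Phi>"


section \<open>Representations of the dual group and their weights\<close>

definition irreducible_rep ::
  "('k::field^'n^'n) set \<Rightarrow> ('k^'n^'n \<Rightarrow> 'k^'d^'d) \<Rightarrow> bool" where
  "irreducible_rep G \<pi> \<longleftrightarrow>
     \<pi> \<in> hom (as_group G) GL \<and> (\<forall>i j. regular_on UNIV G (\<lambda>A. \<pi> A $ i $ j)) \<and>
     (\<forall>S. vec.subspace S \<and> (\<forall>A\<in>G. \<forall>x\<in>S. \<pi> A *v x \<in> S) \<longrightarrow> S = {0} \<or> S = UNIV)"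

definition weight_mult ::
  "('k::field^'n^'n) set \<Rightarrow> ('a \<Rightarrow> 'k^'n^'n \<Rightarrow> 'k) \<Rightarrow> ('k^'n^'n \<Rightarrow> 'k^'d^'d) \<Rightarrow> 'a \<Rightarrow> nat" where
  "weight_mult T ch \<pi> l = vec.dim {x. \<forall>t\<in>T. \<pi> t *v x = ch l t *s x}"

definition wt ::
  "('k::field^'n^'n) set \<Rightarrow> ('a::euclidean_space \<Rightarrow> 'k^'n^'n \<Rightarrow> 'k) \<Rightarrow> 'a set \<Rightarrow>
   ('k^'n^'n \<Rightarrow> 'k^'d^'d) \<Rightarrow> 'a multiset" where
  "wt T ch \<Phi> \<pi> = (\<Sum>l\<in>{l\<in>coweight_lattice \<Phi>. weight_mult T ch \<pi> l \<noteq> 0}.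
     replicate_mset (weight_mult T ch \<pi> l) l)"

definition wt' ::
  "('k::field^'n^'n) set \<Rightarrow> ('a::euclidean_space \<Rightarrow> 'k^'n^'n \<Rightarrow> 'k) \<Rightarrow> 'a set \<Rightarrow>
   ('k^'n^'n \<Rightarrow> 'k^'d^'d) \<Rightarrow> 'a multiset" where
  "wt' T ch \<Phi> \<pi> = filter_mset (\<lambda>l. l \<noteq> 0) (wt T ch \<Phi> \<pi>)"


section \<open>Unramified representations and the L-function\<close>

text \<open>
  Functions on \<open>W\<^sub>e\<^sub>x\<^sub>t\<close> are extended by zero to all maps \<open>V \<Rightarrow> V\<close>. The group \<open>W\<^sub>e\<^sub>x\<^sub>t\<close> acts on them
  by right translation.
\<close>

definition rtrans :: "('a \<Rightarrow> 'a) \<Rightarrow> (('a \<Rightarrow> 'a) \<Rightarrow> complex) \<Rightarrow> ('a \<Rightarrow> 'a) \<Rightarrow> complex" where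
  "rtrans h f = (\<lambda>g. f (g \<circ> h))"

text \<open>There is no summability condition, since \<open>\<Gamma>\<close> will have finite index.\<close>

definition L2 ::
  "'a::euclidean_space set \<Rightarrow> ('a \<Rightarrow> 'a) set \<Rightarrow> (('a \<Rightarrow> 'a) \<Rightarrow> complex) set" where
  "L2 \<Phi> \<Gamma> = {f. (\<forall>g. g \<notin> ext_affine_weyl \<Phi> \<longrightarrow> f g = 0) \<and>
     (\<forall>\<gamma>\<in>\<Gamma>. \<forall>g\<in>ext_affine_weyl \<Phi>. f (\<gamma> \<circ> g) = f g)}"

definition lattice_character :: "'a::euclidean_space set \<Rightarrow> ('a \<Rightarrow> complex) \<Rightarrow> bool" where
  "lattice_character L \<xi> \<longleftrightarrow>
     (\<forall>l\<in>L. \<xi> l \<noteq> 0) \<and> (\<forall>l\<in>L. \<forall>m\<in>L. \<xi> (l + m) = \<xi> l * \<xi> m)"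

definition Ind :: "'a::euclidean_space set \<Rightarrow> ('a \<Rightarrow> complex) \<Rightarrow> (('a \<Rightarrow> 'a) \<Rightarrow> complex) set" where
  "Ind \<Phi> \<xi> = {f. (\<forall>g. g \<notin> ext_affine_weyl \<Phi> \<longrightarrow> f g = 0) \<and>
     (\<forall>l\<in>coweight_lattice \<Phi>. \<forall>g\<in>ext_affine_weyl \<Phi>. f ((\<lambda>v. v + l) \<circ> g) = \<xi> l * f g)}"

definition subrep ::
  "'a::euclidean_space set \<Rightarrow> (('a \<Rightarrow> 'a) \<Rightarrow> complex) set \<Rightarrow> (('a \<Rightarrow> 'a) \<Rightarrow> complex) set \<Rightarrow> bool" where
  "subrep \<Phi> M U \<longleftrightarrow> U \<subseteq> M \<and> (\<lambda>_. 0) \<in> U \<and>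
     (\<forall>f\<in>U. \<forall>f'\<in>U. \<forall>a b. (\<lambda>g. a * f g + b * f' g) \<in> U) \<and>
     (\<forall>h\<in>ext_affine_weyl \<Phi>. \<forall>f\<in>U. rtrans h f \<in> U)"

definition irreducible_subrep ::
  "'a::euclidean_space set \<Rightarrow> (('a \<Rightarrow> 'a) \<Rightarrow> complex) set \<Rightarrow> (('a \<Rightarrow> 'a) \<Rightarrow> complex) set \<Rightarrow> bool" where
  "irreducible_subrep \<Phi> M U \<longleftrightarrow> subrep \<Phi> M U \<and> U \<noteq> {\<lambda>_. 0} \<and>
     (\<forall>U'. subrep \<Phi> U U' \<longrightarrow> U' = {\<lambda>_. 0} \<or> U' = U)"

definition unramified :: "'a::euclidean_space set \<Rightarrow> (('a \<Rightarrow> 'a) \<Rightarrow> complex) set \<Rightarrow> bool" where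
  "unramified \<Phi> U \<longleftrightarrow> (\<exists>f\<in>U. f \<noteq> (\<lambda>_. 0) \<and> (\<forall>w\<in>weyl \<Phi>. rtrans w f = f))"

definition rep_iso ::
  "'a::euclidean_space set \<Rightarrow> (('a \<Rightarrow> 'a) \<Rightarrow> complex) set \<Rightarrow> (('a \<Rightarrow> 'a) \<Rightarrow> complex) set \<Rightarrow> bool" where
  "rep_iso \<Phi> U U' \<longleftrightarrow> (\<exists>\<theta>. bij_betw \<theta> U U' \<and>
     (\<forall>f\<in>U. \<forall>f'\<in>U. \<forall>a b. \<theta> (\<lambda>g. a * f g + b * f' g) = (\<lambda>g. a * \<theta> f g + b * \<theta> f' g)) \<and>
     (\<forall>h\<in>ext_affine_weyl \<Phi>. \<forall>f\<in>U. \<theta> (rtrans h f) = rtrans h (\<theta> f)))"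

text \<open>The relation between \<open>\<rho>\<close> and \<open>\<chi>\<^sub>\<rho>\<close>, which is determined by \<open>\<rho>\<close> only up to the Weyl group.\<close>

definition has_character ::
  "'a::euclidean_space set \<Rightarrow> (('a \<Rightarrow> 'a) \<Rightarrow> complex) set \<Rightarrow> ('a \<Rightarrow> complex) \<Rightarrow> bool" where
  "has_character \<Phi> \<rho> \<xi> \<longleftrightarrow> lattice_character (coweight_lattice \<Phi>) \<xi> \<and>
     (\<exists>U. irreducible_subrep \<Phi> (Ind \<Phi> \<xi>) U \<and> unramified \<Phi> U \<and> rep_iso \<Phi> \<rho> U \<and>
        (\<forall>U'. irreducible_subrep \<Phi> (Ind \<Phi> \<xi>) U' \<and> unramified \<Phi> U' \<longrightarrow> U' = U))"

text \<open>
  A decomposition into irreducibles is a set of subspaces in direct sum; isomorphic constituents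
  are distinct members, so that its members represent the multiset of irreducible
  subrepresentations.
\<close>

definition irr_decomposition ::
  "'a::euclidean_space set \<Rightarrow> (('a \<Rightarrow> 'a) \<Rightarrow> complex) set \<Rightarrow>
   (('a \<Rightarrow> 'a) \<Rightarrow> complex) set set \<Rightarrow> bool" where
  "irr_decomposition \<Phi> M D \<longleftrightarrow> finite D \<and> (\<forall>U\<in>D. irreducible_subrep \<Phi> M U) \<and>
     (\<forall>f\<in>M. \<exists>!c. (\<forall>U\<in>D. c U \<in> U) \<and> (\<forall>U. U \<notin> D \<longrightarrow> c U = (\<lambda>_. 0)) \<and>
        f = (\<lambda>g. \<Sum>U\<in>D. c U g))"

definition L_function ::
  "'r set \<Rightarrow> ('r \<Rightarrow> 'a \<Rightarrow> complex) \<Rightarrow> 'a multiset \<Rightarrow> complex \<Rightarrow> complex" where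
  "L_function Irr \<xi> M u = (\<Prod>\<rho>\<in>Irr. \<Prod>l\<in>#M. inverse (1 - \<xi> \<rho> l * u))"


section \<open>Counting closed walks and double cosets\<close>

definition orbit_reps :: "('a \<Rightarrow> 'a) set \<Rightarrow> 'a set \<Rightarrow> 'a set \<Rightarrow> bool" where
  "orbit_reps \<Gamma> L S \<longleftrightarrow> S \<subseteq> L \<and> (\<forall>y\<in>L. \<exists>!x. x \<in> S \<and> (\<exists>\<gamma>\<in>\<Gamma>. \<gamma> x = y))"

text \<open>
  The walk attached to \<open>(x, l, \<gamma>)\<close> is the image in the quotient of the segment from \<open>x\<close>
  to \<open>x + n l\<close>; \<open>S\<close> is a set of representatives of the hyperspecial vertices modulo \<open>\<Gamma>\<close>.
\<close>

definition closed_walks ::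
  "('a::euclidean_space \<Rightarrow> 'a) set \<Rightarrow> 'a set \<Rightarrow> 'a multiset \<Rightarrow> nat \<Rightarrow> real" where
  "closed_walks \<Gamma> S M n =
     (\<Sum>l\<in>#M. \<Sum>\<^sub>\<infinity>\<gamma>\<in>\<Gamma>. real (card {x\<in>S. \<gamma> x = x + real n *\<^sub>R l}))"

definition double_cosets ::
  "('a \<Rightarrow> 'a) set \<Rightarrow> ('a \<Rightarrow> 'a) set \<Rightarrow> ('a \<Rightarrow> 'a) set \<Rightarrow> ('a \<Rightarrow> 'a) set set" where
  "double_cosets H G K = (\<lambda>g. {h \<circ> g \<circ> k | h k. h \<in> H \<and> k \<in> K}) ` G"

end

theory Submission
  imports Defs
begin

text \<open>
  The theorem is a trace formula. The Weyl-fixed vectors of \<open>L2\<close> are the functions on the finite set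
  of hyperspecial vertices modulo \<open>\<Gamma>\<close>. The multiset \<open>M\<close> of nonzero weights is stable under the Weyl
  group, so for each \<open>n\<close> the operator \<open>A\<^sub>n\<close> that sums the translates by \<open>n l\<close>, for \<open>l\<close> in \<open>M\<close>, acts on
  these functions.

  In the basis of indicator functions of the vertices, the diagonal entry of \<open>A\<^sub>n\<close> at \<open>x\<close> is the number
  of \<open>l\<close> in \<open>M\<close> with \<open>x + n l\<close> in the \<open>\<Gamma>\<close>-orbit of \<open>x\<close>. A torsion-free \<open>\<Gamma>\<close> acts freely, because
  point stabilizers in the affine Weyl group are finite; hence the element of \<open>\<Gamma>\<close> that moves \<open>x\<close> to
  \<open>x + n l\<close> is unique, and the trace is the number of closed walks (\<open>count_translates\<close>).

  On the other hand the Weyl-fixed vectors have a basis of spherical vectors, one from each unramified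
  constituent \<open>\<rho>\<close>: in the representation induced from a character \<open>\<xi>\<close> of the lattice, a Weyl-fixed
  vector is determined by its value at the identity. It is an eigenvector of \<open>A\<^sub>n\<close> with eigenvalue the
  sum of \<open>\<xi> l ^ n\<close> over \<open>M\<close> (\<open>Ind_translation_sum\<close>). Comparing traces expresses the number of walks
  as a power sum in the numbers \<open>\<xi> \<rho> l\<close> (\<open>trace_formula\<close>, \<open>closed_walks_eq_character_sum\<close>). The trace
  of the identity shows that there are as many unramified constituents as double cosets (\<open>card_Unr\<close>,
  \<open>card_double_cosets\<close>). The numbers \<open>\<xi> \<rho> l\<close> are roots of unity, since a positive multiple of each
  coweight acts trivially on \<open>L2\<close> (\<open>norm_character\<close>). For \<open>norm u < 1\<close> the generating function of the
  power sums therefore converges, and its exponential is the product of \<open>1 / (1 - \<xi> \<rho> l u)\<close>. The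
  trivial weights contribute the remaining power of \<open>1 - u\<close>.

  The Weyl group stability of \<open>M\<close> holds because each reflection is induced by conjugation with an
  element of the group, the image of \<open>((0, 1), (-1, 0))\<close> under the homomorphism from \<open>SL\<^sub>2\<close> attached to
  the root (\<open>reflection_representative\<close>, \<open>weight_mult_weyl\<close>).
\<close>

section \<open>The Weyl group and the two lattices\<close>

lemma coroot_inner_self:
  assumes "\<alpha> \<noteq> 0"
  shows "\<alpha> \<bullet> coroot \<alpha> = 2"
  using assms by (simp add: coroot_def)

lemma linear_refl: "linear (refl \<alpha>)"
  by (rule linearI) (simp_all add: refl_def inner_add_right scaleR_add_left algebra_simps)

lemma refl_refl:
  assumes "\<alpha> \<noteq> 0"
  shows "refl \<alpha> (refl \<alpha> v) = v"
proof -
  have "\<alpha> \<bullet> (v - (\<alpha> \<bullet> v) *\<^sub>R coroot \<alpha>) = - (\<alpha> \<bullet> v)"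
    using coroot_inner_self[OF assms] by (simp add: inner_diff_right)
  then show ?thesis by (simp add: refl_def)
qed

lemma coroot_coroot: "\<alpha> \<noteq> 0 \<Longrightarrow> coroot (coroot \<alpha>) = \<alpha>"
  by (simp add: coroot_def field_simps)

lemma group_closure_scaleR_of_int:
  fixes A :: "'b::real_vector set"
  assumes "s \<in> group_closure A"
  shows "of_int k *\<^sub>R s \<in> group_closure A"
proof (induction k rule: int_induct[where k = 0])
  case (step1 i)
  then show ?case using assms group_closure_add by (simp add: scaleR_add_left)
next
  case (step2 i)
  then show ?case using assms by (simp add: scaleR_diff_left group_closure.diff)
qed simp

text \<open>
  A crystallographic root system in a Euclidean space, with its Weyl group, its coweight and coroot
  lattices, and the two affine groups.
\<close>

locale rootsys =
  fixes \<Phi> :: "'a::euclidean_space set"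
  assumes rs: "root_system \<Phi>"
begin

abbreviation W :: "('a \<Rightarrow> 'a) set" where "W \<equiv> weyl \<Phi>"
abbreviation coweights :: "'a set" where "coweights \<equiv> coweight_lattice \<Phi>"
abbreviation coroots :: "'a set" where "coroots \<equiv> coroot_lattice \<Phi>"
abbreviation Wext :: "('a \<Rightarrow> 'a) set" where "Wext \<equiv> ext_affine_weyl \<Phi>"
abbreviation Waff :: "('a \<Rightarrow> 'a) set" where "Waff \<equiv> affine_weyl \<Phi>"

lemma finite_roots: "finite \<Phi>" and span_roots: "span \<Phi> = UNIV"
  and root_nonzero: "\<alpha> \<in> \<Phi> \<Longrightarrow> \<alpha> \<noteq> 0"
  and refl_image_roots: "\<alpha> \<in> \<Phi> \<Longrightarrow> refl \<alpha> ` \<Phi> = \<Phi>"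
  and inner_coroot_Ints: "\<alpha> \<in> \<Phi> \<Longrightarrow> \<beta> \<in> \<Phi> \<Longrightarrow> \<beta> \<bullet> coroot \<alpha> \<in> \<int>"
  using rs by (auto simp: root_system_def)

lemma weyl_linear: "w \<in> W \<Longrightarrow> linear w"
proof (induction rule: weyl.induct)
  case id
  show ?case by (rule linear_id)
next
  case (refl \<alpha> w)
  then show ?case using linear_compose linear_refl by blast
qed

lemma weyl_zero [simp]: "w \<in> W \<Longrightarrow> w 0 = 0"
  using linear_0 weyl_linear by blast

lemma weyl_comp: "w \<in> W \<Longrightarrow> w' \<in> W \<Longrightarrow> w \<circ> w' \<in> W"
  by (induction rule: weyl.induct) (auto simp: comp_assoc intro: weyl.intros)

lemma refl_in_weyl: "\<alpha> \<in> \<Phi> \<Longrightarrow> refl \<alpha> \<in> W"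
  using weyl.refl[OF _ weyl.id] by simp

lemma weyl_inverse:
  assumes "w \<in> W"
  shows "\<exists>w'\<in>W. w \<circ> w' = id \<and> w' \<circ> w = id"
  using assms
proof (induction rule: weyl.induct)
  case id
  show ?case by (rule bexI[of _ id]) (auto intro: weyl.id)
next
  case (refl \<alpha> w)
  then obtain w' where w': "w' \<in> W" "w \<circ> w' = id" "w' \<circ> w = id" by blast
  have rr: "refl \<alpha> \<circ> refl \<alpha> = id" by (rule ext) (simp add: refl_refl root_nonzero[OF refl(1)])
  have "(refl \<alpha> \<circ> w) \<circ> (w' \<circ> refl \<alpha>) = refl \<alpha> \<circ> (w \<circ> w') \<circ> refl \<alpha>"
    "(w' \<circ> refl \<alpha>) \<circ> (refl \<alpha> \<circ> w) = w' \<circ> (refl \<alpha> \<circ> refl \<alpha>) \<circ> w"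
    by (simp_all only: comp_assoc)
  then have "(refl \<alpha> \<circ> w) \<circ> (w' \<circ> refl \<alpha>) = id" "(w' \<circ> refl \<alpha>) \<circ> (refl \<alpha> \<circ> w) = id"
    by (simp_all only: w' rr comp_id)
  then show ?case using weyl_comp[OF w'(1) refl_in_weyl[OF refl(1)]] by blast
qed

lemma weyl_inj: "w \<in> W \<Longrightarrow> inj w"
  using weyl_inverse by (metis inj_on_id inj_on_imageI2)

lemma weyl_image_roots: "w \<in> W \<Longrightarrow> w ` \<Phi> = \<Phi>"
  by (induction rule: weyl.induct) (simp, simp only: image_comp[symmetric] refl_image_roots)

text \<open>A Weyl group element is determined by the permutation of the finite spanning set of roots.\<close>

lemma finite_weyl: "finite W"
proof (rule inj_on_finite)
  show "inj_on (\<lambda>w. restrict w \<Phi>) W"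
  proof (rule inj_onI)
    fix w w' assume w: "w \<in> W" "w' \<in> W" "restrict w \<Phi> = restrict w' \<Phi>"
    have "w x = w' x" for x
    proof (rule linear_eq_on[of w w' x \<Phi>])
      show "w b = w' b" if "b \<in> \<Phi>" for b using w(3) that by (metis restrict_apply')
    qed (use w weyl_linear span_roots in auto)
    then show "w = w'" by blast
  qed
  show "(\<lambda>w. restrict w \<Phi>) ` W \<subseteq> \<Phi> \<rightarrow>\<^sub>E \<Phi>" using weyl_image_roots by (intro image_subsetI restrict_PiE_iff[THEN iffD2]) blast
  show "finite (\<Phi> \<rightarrow>\<^sub>E \<Phi>)" using finite_roots by (simp add: finite_PiE)
qed

lemma weyl_finite_order:
  assumes "w \<in> W"
  shows "\<exists>m>0. w ^^ m = id"
proof -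
  have pow: "w ^^ n \<in> W" for n
    by (induction n) (simp_all only: funpow.simps weyl.id weyl_comp[OF assms])
  have "\<not> inj (\<lambda>n. w ^^ n)"
    using finite_weyl pow finite_subset[of "range (\<lambda>n. w ^^ n)" W] finite_imageD[of "\<lambda>n. w ^^ n" UNIV]
    by auto
  then obtain i j where "w ^^ i = w ^^ j" "i \<noteq> j" unfolding inj_def by blast
  then obtain i j where ij: "w ^^ i = w ^^ j" "i < j" by (metis linorder_neqE_nat)
  have "(w ^^ i) \<circ> (w ^^ (j - i)) = w ^^ (i + (j - i))" by (simp only: funpow_add)
  also have "\<dots> = w ^^ i \<circ> id" using ij by simp
  finally have "(w ^^ i) \<circ> (w ^^ (j - i)) = w ^^ i \<circ> id" .
  then have "w ^^ (j - i) = id"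
    using weyl_inj[OF pow[of i]] by (metis fun.inj_map_strong injD comp_apply ext)
  then show ?thesis using ij by (intro exI[of _ "j - i"]) auto
qed

lemma coweights_add: "l \<in> coweights \<Longrightarrow> m \<in> coweights \<Longrightarrow> l + m \<in> coweights"
  and coweights_diff: "l \<in> coweights \<Longrightarrow> m \<in> coweights \<Longrightarrow> l - m \<in> coweights"
  and coweights_zero [simp]: "0 \<in> coweights"
  and coweights_minus: "l \<in> coweights \<Longrightarrow> - l \<in> coweights"
  and coweights_nat: "l \<in> coweights \<Longrightarrow> real n *\<^sub>R l \<in> coweights"
  by (auto simp: coweight_lattice_def inner_add_right inner_diff_right)

lemma coroots_add: "l \<in> coroots \<Longrightarrow> m \<in> coroots \<Longrightarrow> l + m \<in> coroots"
  and coroots_zero [simp]: "0 \<in> coroots"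
  and coroots_minus: "l \<in> coroots \<Longrightarrow> - l \<in> coroots"
  by (auto simp: coroot_lattice_def group_closure_add)

lemma coroot_in_coroots: "\<alpha> \<in> \<Phi> \<Longrightarrow> coroot \<alpha> \<in> coroots"
  by (auto simp: coroot_lattice_def intro: group_closure.base)

lemma coroots_subset_coweights: "coroots \<subseteq> coweights"
proof
  fix l assume "l \<in> coroots"
  then show "l \<in> coweights" unfolding coroot_lattice_def
  proof (induction rule: group_closure.induct)
    case (base s)
    then show ?case using inner_coroot_Ints by (auto simp: coweight_lattice_def)
  qed (rule coweights_diff)
qed

lemma coroots_sum: "(\<And>x. x \<in> A \<Longrightarrow> f x \<in> coroots) \<Longrightarrow> sum f A \<in> coroots"
  by (induction A rule: infinite_finite_induct) (auto simp: coroots_add)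

lemma weyl_coroots:
  assumes "w \<in> W" "m \<in> coroots"
  shows "w m \<in> coroots"
  using assms
proof (induction rule: weyl.induct)
  case (refl \<alpha> w)
  then have wm: "w m \<in> coroots" by blast
  then have "\<alpha> \<bullet> w m \<in> \<int>"
    using refl(1) coroots_subset_coweights by (auto simp: coweight_lattice_def)
  then obtain k where k: "\<alpha> \<bullet> w m = of_int k" by (auto elim: Ints_cases)
  have "of_int k *\<^sub>R coroot \<alpha> \<in> coroots"
    using coroot_in_coroots[OF refl(1)] group_closure_scaleR_of_int
    by (auto simp: coroot_lattice_def)
  then show ?case using wm k
    by (auto simp: refl_def coroot_lattice_def intro: group_closure.diff)
qed simp

lemma weyl_coweights:
  assumes "w \<in> W" "m \<in> coweights"
  shows "w m \<in> coweights"
  using assms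
proof (induction rule: weyl.induct)
  case (refl \<alpha> w)
  then show ?case using inner_coroot_Ints
    by (auto simp: refl_def coweight_lattice_def inner_diff_right)
qed simp

text \<open>The coweight lattice is discrete: a coweight is determined by its integral pairings with the roots.\<close>

lemma finite_bounded_coweights: "finite {l \<in> coweights. norm l \<le> B}"
proof (rule inj_on_finite)
  define C where "C = B * (\<Sum>\<alpha>\<in>\<Phi>. norm \<alpha>)"
  let ?p = "\<lambda>l. restrict (\<lambda>\<alpha>. \<lfloor>\<alpha> \<bullet> l\<rfloor>) \<Phi>"
  show "inj_on ?p {l \<in> coweights. norm l \<le> B}"
  proof (rule inj_onI)
    fix l m assume lm: "l \<in> {l \<in> coweights. norm l \<le> B}" "m \<in> {l \<in> coweights. norm l \<le> B}"
      "?p l = ?p m"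
    have "\<alpha> \<bullet> l = \<alpha> \<bullet> m" if "\<alpha> \<in> \<Phi>" for \<alpha>
    proof -
      have "\<lfloor>\<alpha> \<bullet> l\<rfloor> = \<lfloor>\<alpha> \<bullet> m\<rfloor>" using lm(3) that by (metis restrict_apply')
      moreover have "\<alpha> \<bullet> l \<in> \<int>" "\<alpha> \<bullet> m \<in> \<int>"
        using lm that by (auto simp: coweight_lattice_def)
      ultimately show ?thesis by (metis Ints_cases floor_of_int)
    qed
    then have "orthogonal (l - m) \<alpha>" if "\<alpha> \<in> \<Phi>" for \<alpha>
      using that inner_commute[of l \<alpha>] inner_commute[of m \<alpha>]
      by (simp add: orthogonal_def inner_diff_left)
    then have "orthogonal (l - m) x" if "x \<in> span \<Phi>" for x
      using that orthogonal_to_span by blast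
    then show "l = m" using span_roots orthogonal_self[of "l - m"] by auto
  qed
  show "?p ` {l \<in> coweights. norm l \<le> B} \<subseteq> \<Phi> \<rightarrow>\<^sub>E {\<lfloor>- C\<rfloor> .. \<lceil>C\<rceil>}"
  proof (intro image_subsetI, clarsimp simp: PiE_def Pi_def)
    fix l \<alpha> assume l: "l \<in> coweights" "norm l \<le> B" "\<alpha> \<in> \<Phi>"
    have "\<bar>\<alpha> \<bullet> l\<bar> \<le> norm \<alpha> * norm l" by (rule Cauchy_Schwarz_ineq2)
    also have "\<dots> \<le> (\<Sum>\<alpha>\<in>\<Phi>. norm \<alpha>) * B"
      using l finite_roots by (intro mult_mono member_le_sum sum_nonneg) auto
    finally have "\<bar>\<alpha> \<bullet> l\<bar> \<le> C" by (simp add: C_def mult.commute)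
    then show "\<lfloor>- C\<rfloor> \<le> \<lfloor>\<alpha> \<bullet> l\<rfloor> \<and> \<lfloor>\<alpha> \<bullet> l\<rfloor> \<le> \<lceil>C\<rceil>" by linarith
  qed
  show "finite (\<Phi> \<rightarrow>\<^sub>E {\<lfloor>- C\<rfloor> .. \<lceil>C\<rceil>})" using finite_roots by (simp add: finite_PiE)
qed

lemma span_coroots: "span (coroot ` \<Phi>) = UNIV"
proof -
  have "\<alpha> \<in> span (coroot ` \<Phi>)" if "\<alpha> \<in> \<Phi>" for \<alpha>
  proof -
    have "\<alpha> = ((\<alpha> \<bullet> \<alpha>) / 2) *\<^sub>R coroot \<alpha>"
      using root_nonzero[OF that] by (simp add: coroot_def)
    then show ?thesis using that by (metis imageI span_base span_scale)
  qed
  then have "span \<Phi> \<subseteq> span (coroot ` \<Phi>)" by (simp add: span_minimal subsetI)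
  then show ?thesis using span_roots by auto
qed

text \<open>
  The coroot lattice is cocompact, as the coroots span; since the coweights are discrete, finitely
  many of them represent all classes modulo the coroots.
\<close>

lemma coroots_finite_index:
  "\<exists>F. finite F \<and> F \<subseteq> coweights \<and> (\<forall>l\<in>coweights. \<exists>m\<in>coroots. \<exists>f\<in>F. l = f + m)"
proof -
  define B where "B = (\<Sum>x\<in>coroot ` \<Phi>. norm x)"
  let ?F = "{l \<in> coweights. norm l \<le> B}"
  \<comment> \<open>Rounding down the coefficients of \<open>l\<close> in terms of the coroots leaves a remainder in \<open>?F\<close>.\<close>
  have "\<exists>m\<in>coroots. \<exists>f\<in>?F. l = f + m" if l: "l \<in> coweights" for l
  proof -
    have fin: "finite (coroot ` \<Phi>)" using finite_roots by simp
    have "l \<in> span (coroot ` \<Phi>)" using span_coroots by simp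
    then obtain c where c: "l = (\<Sum>x\<in>coroot ` \<Phi>. c x *\<^sub>R x)"
      unfolding span_finite[OF fin] by blast
    define m where "m = (\<Sum>x\<in>coroot ` \<Phi>. of_int \<lfloor>c x\<rfloor> *\<^sub>R x)"
    have m: "m \<in> coroots" unfolding m_def
      using coroot_in_coroots group_closure_scaleR_of_int
      by (intro coroots_sum) (auto simp: coroot_lattice_def)
    have lm: "l - m = (\<Sum>x\<in>coroot ` \<Phi>. frac (c x) *\<^sub>R x)"
      by (simp add: c m_def frac_def scaleR_diff_left sum_subtractf)
    have "norm (l - m) \<le> B" unfolding lm B_def
      by (rule order_trans[OF norm_sum], rule sum_mono)
        (auto simp: frac_ge_0 intro!: mult_left_le_one_le order.strict_implies_order[OF frac_lt_1])
    then show ?thesis using m l coweights_diff coroots_subset_coweights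
      by (intro bexI[of _ m] bexI[of _ "l - m"]) auto
  qed
  then show ?thesis using finite_bounded_coweights by (intro exI[of _ ?F]) auto
qed

end

section \<open>The affine groups and the action of a torsion-free subgroup\<close>

abbreviation transl :: "'b::real_vector \<Rightarrow> 'b \<Rightarrow> 'b" where
  "transl l \<equiv> (\<lambda>v. v + l)"

context rootsys begin

lemma Wext_I: "w \<in> W \<Longrightarrow> l \<in> coweights \<Longrightarrow> transl l \<circ> w \<in> Wext"
  by (auto simp: ext_affine_weyl_def comp_def)

lemma Waff_I: "w \<in> W \<Longrightarrow> l \<in> coroots \<Longrightarrow> transl l \<circ> w \<in> Waff"
  by (auto simp: affine_weyl_def comp_def)

lemma Wext_E:
  assumes "g \<in> Wext"
  obtains w l where "w \<in> W" "l \<in> coweights" "g = transl l \<circ> w"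
  using assms by (auto simp: ext_affine_weyl_def comp_def)

lemma Waff_E:
  assumes "g \<in> Waff"
  obtains w l where "w \<in> W" "l \<in> coroots" "g = transl l \<circ> w"
  using assms by (auto simp: affine_weyl_def comp_def)

lemma Waff_subset_Wext: "Waff \<subseteq> Wext"
  using coroots_subset_coweights by (fastforce simp: affine_weyl_def ext_affine_weyl_def)

lemma transl_in_Wext: "l \<in> coweights \<Longrightarrow> transl l \<in> Wext"
  using Wext_I[OF weyl.id] by simp

lemma transl_in_Waff: "l \<in> coroots \<Longrightarrow> transl l \<in> Waff"
  using Waff_I[OF weyl.id] by simp

lemma weyl_subset_Wext: "W \<subseteq> Wext"
  using Wext_I[OF _ coweights_zero] by (auto simp: comp_def)

lemma affine_comp:
  assumes "w \<in> W"
  shows "(transl l \<circ> w) \<circ> (transl m \<circ> w') = transl (l + w m) \<circ> (w \<circ> w')"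
  using assms by (auto simp: comp_def linear_add[OF weyl_linear] algebra_simps)

lemma Wext_comp:
  assumes "g \<in> Wext" "h \<in> Wext"
  shows "g \<circ> h \<in> Wext"
proof -
  obtain w l where g: "w \<in> W" "l \<in> coweights" "g = transl l \<circ> w" by (rule Wext_E[OF assms(1)])
  obtain w' l' where h: "w' \<in> W" "l' \<in> coweights" "h = transl l' \<circ> w'" by (rule Wext_E[OF assms(2)])
  show ?thesis unfolding g(3) h(3) affine_comp[OF g(1)]
    by (rule Wext_I[OF weyl_comp[OF g(1) h(1)] coweights_add[OF g(2) weyl_coweights[OF g(1) h(2)]]])
qed

lemma Waff_comp:
  assumes "g \<in> Waff" "h \<in> Waff"
  shows "g \<circ> h \<in> Waff"
proof -
  obtain w l where g: "w \<in> W" "l \<in> coroots" "g = transl l \<circ> w" by (rule Waff_E[OF assms(1)])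
  obtain w' l' where h: "w' \<in> W" "l' \<in> coroots" "h = transl l' \<circ> w'" by (rule Waff_E[OF assms(2)])
  show ?thesis unfolding g(3) h(3) affine_comp[OF g(1)]
    by (rule Waff_I[OF weyl_comp[OF g(1) h(1)] coroots_add[OF g(2) weyl_coroots[OF g(1) h(2)]]])
qed

lemma Waff_inverse:
  assumes "g \<in> Waff"
  shows "\<exists>h\<in>Waff. h \<circ> g = id"
proof -
  obtain w l where g: "w \<in> W" "l \<in> coroots" "g = transl l \<circ> w" by (rule Waff_E[OF assms(1)])
  obtain w' where w': "w' \<in> W" "w' \<circ> w = id" using weyl_inverse g by blast
  have "(transl (- w' l) \<circ> w') \<circ> g = id"
    unfolding g(3) affine_comp[OF w'(1)] w'(2) by auto
  moreover have "transl (- w' l) \<circ> w' \<in> Waff"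
    by (rule Waff_I[OF w'(1) coroots_minus[OF weyl_coroots[OF w'(1) g(2)]]])
  ultimately show ?thesis by blast
qed

lemma Wext_coweights: "g \<in> Wext \<Longrightarrow> x \<in> coweights \<Longrightarrow> g x \<in> coweights"
  by (erule Wext_E) (auto intro: coweights_add weyl_coweights)

lemma group_Waff: "group (comp_group Waff)"
proof (rule groupI)
  have "id \<in> Waff" using Waff_I[OF weyl.id coroots_zero] by (simp add: comp_def id_def)
  then show "\<one>\<^bsub>comp_group Waff\<^esub> \<in> carrier (comp_group Waff)" by (simp add: comp_group_def)
qed (use Waff_comp Waff_inverse in \<open>auto simp: comp_group_def comp_assoc\<close>)

end

text \<open>
  A torsion-free subgroup \<open>\<Gamma>\<close> of finite index in the affine Weyl group; it acts on the space by evaluation.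
\<close>

locale affine_subgroup = rootsys \<Phi> for \<Phi> :: "'a::euclidean_space set" +
  fixes \<Gamma> :: "('a \<Rightarrow> 'a) set"
  assumes subgroup_Gamma: "subgroup \<Gamma> (comp_group (affine_weyl \<Phi>))"
    and finite_index_Gamma: "finite_index (comp_group (affine_weyl \<Phi>)) \<Gamma>"
    and torsion_free_Gamma: "torsion_free \<Gamma>"
begin

lemma Gamma_subset_Waff: "\<Gamma> \<subseteq> Waff"
  and Gamma_comp: "\<gamma> \<in> \<Gamma> \<Longrightarrow> \<delta> \<in> \<Gamma> \<Longrightarrow> \<gamma> \<circ> \<delta> \<in> \<Gamma>"
  and Gamma_id: "id \<in> \<Gamma>"
  using subgroup_Gamma by (auto simp: subgroup_def comp_group_def)

lemma Gamma_subset_Wext: "\<Gamma> \<subseteq> Wext"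
  using Gamma_subset_Waff Waff_subset_Wext by blast

lemma Gamma_inverse:
  assumes "\<gamma> \<in> \<Gamma>"
  shows "\<exists>\<delta>\<in>\<Gamma>. \<delta> \<circ> \<gamma> = id \<and> \<gamma> \<circ> \<delta> = id"
proof -
  interpret group "comp_group Waff" by (rule group_Waff)
  have "\<gamma> \<in> carrier (comp_group Waff)" using assms Gamma_subset_Waff by (auto simp: comp_group_def)
  then show ?thesis using l_inv[of \<gamma>] r_inv[of \<gamma>] subgroup.m_inv_closed[OF subgroup_Gamma assms]
    by (auto simp: comp_group_def)
qed

lemma Gamma_coset_reps: "\<exists>F. finite F \<and> F \<subseteq> Waff \<and> (\<forall>g\<in>Waff. \<exists>\<gamma>\<in>\<Gamma>. \<exists>f\<in>F. g = \<gamma> \<circ> f)"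
proof -
  let ?G = "comp_group Waff"
  define rep where "rep C = (SOME g. g \<in> C)" for C :: "('a \<Rightarrow> 'a) set"
  let ?F = "rep ` (rcosets\<^bsub>?G\<^esub> \<Gamma>)"
  have coset: "\<Gamma> #>\<^bsub>?G\<^esub> g = (\<lambda>\<gamma>. \<gamma> \<circ> g) ` \<Gamma>" for g
    by (auto simp: r_coset_def comp_group_def)
  have rep: "\<exists>\<gamma>\<in>\<Gamma>. rep (\<Gamma> #>\<^bsub>?G\<^esub> g) = \<gamma> \<circ> g" if "g \<in> Waff" for g
  proof -
    have "g \<in> \<Gamma> #>\<^bsub>?G\<^esub> g" unfolding coset using Gamma_id by (metis id_comp image_eqI)
    then have "rep (\<Gamma> #>\<^bsub>?G\<^esub> g) \<in> \<Gamma> #>\<^bsub>?G\<^esub> g" unfolding rep_def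
      by (rule someI[of "\<lambda>h. h \<in> \<Gamma> #>\<^bsub>?G\<^esub> g"])
    then show ?thesis unfolding coset by blast
  qed
  have "finite ?F" using finite_index_Gamma by (simp add: finite_index_def)
  moreover have "?F \<subseteq> Waff"
  proof
    fix f assume "f \<in> ?F"
    then obtain g where g: "g \<in> Waff" "f = rep (\<Gamma> #>\<^bsub>?G\<^esub> g)"
      by (auto simp: RCOSETS_def comp_group_def)
    then show "f \<in> Waff" using rep[OF g(1)] Gamma_subset_Waff Waff_comp by (metis subsetD)
  qed
  moreover have "\<exists>\<gamma>\<in>\<Gamma>. \<exists>f\<in>?F. g = \<gamma> \<circ> f" if g: "g \<in> Waff" for g
  proof -
    obtain \<gamma> where \<gamma>: "\<gamma> \<in> \<Gamma>" "rep (\<Gamma> #>\<^bsub>?G\<^esub> g) = \<gamma> \<circ> g" using rep[OF g] by blast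
    obtain \<delta> where \<delta>: "\<delta> \<in> \<Gamma>" "\<delta> \<circ> \<gamma> = id" using Gamma_inverse \<gamma> by blast
    have "\<delta> \<circ> rep (\<Gamma> #>\<^bsub>?G\<^esub> g) = (\<delta> \<circ> \<gamma>) \<circ> g" by (simp only: \<gamma>(2) comp_assoc)
    then have "g = \<delta> \<circ> rep (\<Gamma> #>\<^bsub>?G\<^esub> g)" by (simp only: \<delta>(2) id_comp)
    moreover have "rep (\<Gamma> #>\<^bsub>?G\<^esub> g) \<in> ?F"
      using g by (auto simp: RCOSETS_def comp_group_def)
    ultimately show ?thesis using \<delta>(1) by blast
  qed
  ultimately show ?thesis by (intro exI[of _ ?F] conjI ballI)
qed

text \<open>
  Translations by coweights need not lie in the affine Weyl group; they still meet only finitely many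
  cosets of \<open>\<Gamma>\<close>, by combining its finite index with that of the coroot lattice.
\<close>

lemma translation_coset_reps: "\<exists>K. finite K \<and> (\<forall>l\<in>coweights. \<exists>\<gamma>\<in>\<Gamma>. \<exists>k\<in>K. transl l = \<gamma> \<circ> k)"
proof -
  obtain F where F: "finite F" "F \<subseteq> Waff" "\<forall>g\<in>Waff. \<exists>\<gamma>\<in>\<Gamma>. \<exists>f\<in>F. g = \<gamma> \<circ> f"
    using Gamma_coset_reps by blast
  obtain E where E: "finite E" "\<forall>l\<in>coweights. \<exists>m\<in>coroots. \<exists>e\<in>E. l = e + m"
    using coroots_finite_index by blast
  let ?K = "(\<lambda>(f, e). f \<circ> transl e) ` (F \<times> E)"
  have "\<exists>\<gamma>\<in>\<Gamma>. \<exists>k\<in>?K. transl l = \<gamma> \<circ> k" if l: "l \<in> coweights" for l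
  proof -
    obtain m e where me: "m \<in> coroots" "e \<in> E" "l = e + m" using bspec[OF E(2) l] by blast
    obtain \<gamma> f where \<gamma>: "\<gamma> \<in> \<Gamma>" "f \<in> F" "transl m = \<gamma> \<circ> f"
      using bspec[OF F(3) transl_in_Waff[OF me(1)]] by blast
    have "transl l = transl m \<circ> transl e" by (rule ext) (simp add: me(3))
    also have "\<dots> = \<gamma> \<circ> (f \<circ> transl e)" by (simp only: \<gamma>(3) comp_assoc)
    finally have "transl l = \<gamma> \<circ> (f \<circ> transl e)" .
    moreover have "f \<circ> transl e \<in> ?K" using \<gamma>(2) me(2) by (intro image_eqI[of _ _ "(f, e)"]) auto
    ultimately show ?thesis using \<gamma>(1) by blast
  qed
  moreover have "finite ?K" using F(1) E(1) by blast
  ultimately show ?thesis by (intro exI[of _ ?K] conjI ballI)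
qed

text \<open>A stabilizer in the affine Weyl group is conjugate, by a translation, to a subgroup of the
  finite group \<open>W\<close>, hence meets a torsion-free group trivially.\<close>

lemma Gamma_fixed_point_imp_id:
  assumes "\<gamma> \<in> \<Gamma>" "\<gamma> x = x"
  shows "\<gamma> = id"
proof -
  obtain w l where g: "w \<in> W" "\<gamma> = transl l \<circ> w"
    by (rule Waff_E[OF subsetD[OF Gamma_subset_Waff assms(1)]])
  obtain m where m: "m > 0" "w ^^ m = id" using weyl_finite_order g by blast
  have step: "\<gamma> y = w (y - x) + x" for y
    using assms(2) by (simp add: g(2) linear_diff[OF weyl_linear[OF g(1)]] algebra_simps)
  have "(\<gamma> ^^ n) y = (w ^^ n) (y - x) + x" for n y
    by (induction n) (simp_all add: step)
  then have "\<gamma> ^^ m = id" using m by auto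
  then show ?thesis using torsion_free_Gamma assms(1) m by (auto simp: torsion_free_def)
qed

lemma Gamma_free:
  assumes "\<gamma> \<in> \<Gamma>" "\<delta> \<in> \<Gamma>" "\<gamma> x = \<delta> x"
  shows "\<gamma> = \<delta>"
proof -
  obtain \<gamma>' where g: "\<gamma>' \<in> \<Gamma>" "\<gamma>' \<circ> \<gamma> = id" "\<gamma> \<circ> \<gamma>' = id" using Gamma_inverse assms by blast
  have "(\<gamma>' \<circ> \<delta>) x = x" using assms(3) g(2) by (metis comp_apply id_apply)
  then have "\<gamma>' \<circ> \<delta> = id" using Gamma_fixed_point_imp_id Gamma_comp g assms by blast
  then show ?thesis using g(3) by (metis comp_assoc comp_id id_comp)
qed

text \<open>Two multiples of \<open>l\<close> give translations in the same coset; their difference lies in \<open>\<Gamma>\<close>.\<close>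

lemma Gamma_translation_multiple:
  assumes "l \<in> coweights"
  shows "\<exists>k>0. transl (real k *\<^sub>R l) \<in> \<Gamma>"
proof -
  obtain K where K: "finite K" "\<forall>l\<in>coweights. \<exists>\<gamma>\<in>\<Gamma>. \<exists>k\<in>K. transl l = \<gamma> \<circ> k"
    using translation_coset_reps by blast
  have "\<forall>j. \<exists>k\<in>K. \<exists>\<gamma>\<in>\<Gamma>. transl (real j *\<^sub>R l) = \<gamma> \<circ> k"
    using K(2) coweights_nat[OF assms] by blast
  then obtain k where k: "\<And>j. k j \<in> K" "\<And>j. \<exists>\<gamma>\<in>\<Gamma>. transl (real j *\<^sub>R l) = \<gamma> \<circ> k j"
    by metis
  have "\<not> inj k" using K(1) k(1) finite_subset[of "range k" K] finite_imageD[of k UNIV] by auto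
  then obtain i j where "k i = k j" "i \<noteq> j" unfolding inj_def by blast
  then obtain i j where ij: "k i = k j" "i < j" by (metis linorder_neqE_nat)
  obtain \<gamma> where \<gamma>: "\<gamma> \<in> \<Gamma>" "transl (real i *\<^sub>R l) = \<gamma> \<circ> k i" using k(2) by blast
  obtain \<delta> where \<delta>: "\<delta> \<in> \<Gamma>" "transl (real j *\<^sub>R l) = \<delta> \<circ> k j" using k(2) by blast
  obtain \<gamma>' where \<gamma>': "\<gamma>' \<in> \<Gamma>" "\<gamma>' \<circ> \<gamma> = id" using Gamma_inverse \<gamma> by blast
  have "k i = \<gamma>' \<circ> transl (real i *\<^sub>R l)" using \<gamma> \<gamma>' by (metis comp_assoc id_comp)
  then have *: "transl (real j *\<^sub>R l) = (\<delta> \<circ> \<gamma>') \<circ> transl (real i *\<^sub>R l)"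
    using \<delta> ij by (simp only: comp_assoc)
  have "transl (real (j - i) *\<^sub>R l) v = (\<delta> \<circ> \<gamma>') v" for v
    using fun_cong[OF *, of "v - real i *\<^sub>R l"] ij
    by (simp add: of_nat_diff scaleR_diff_left algebra_simps)
  then have "transl (real (j - i) *\<^sub>R l) = \<delta> \<circ> \<gamma>'" by (rule ext)
  then show ?thesis using ij Gamma_comp[OF \<delta>(1) \<gamma>'(1)] by (intro exI[of _ "j - i"]) auto
qed

text \<open>
  If translations by \<open>x\<close> and \<open>y\<close> lie in the same coset of \<open>\<Gamma>\<close>, then \<open>x\<close> and \<open>y\<close>, the images of \<open>0\<close>,
  lie in the same orbit.
\<close>

lemma finite_orbit_reps:
  assumes "orbit_reps \<Gamma> coweights S"
  shows "finite S"
proof -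
  obtain K where K: "finite K" "\<forall>l\<in>coweights. \<exists>\<gamma>\<in>\<Gamma>. \<exists>k\<in>K. transl l = \<gamma> \<circ> k"
    using translation_coset_reps by blast
  have S: "S \<subseteq> coweights" "\<And>y. y \<in> coweights \<Longrightarrow> \<exists>!x. x \<in> S \<and> (\<exists>\<gamma>\<in>\<Gamma>. \<gamma> x = y)"
    using assms by (auto simp: orbit_reps_def)
  have "\<forall>x\<in>S. \<exists>k\<in>K. \<exists>\<gamma>\<in>\<Gamma>. \<gamma> (k 0) = x"
  proof
    fix x assume "x \<in> S"
    then obtain \<gamma> k where gk: "\<gamma> \<in> \<Gamma>" "k \<in> K" "transl x = \<gamma> \<circ> k" using K(2) S(1) by blast
    have "\<gamma> (k 0) = x" using fun_cong[OF gk(3), of 0] by simp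
    then show "\<exists>k\<in>K. \<exists>\<gamma>\<in>\<Gamma>. \<gamma> (k 0) = x" using gk by blast
  qed
  then obtain k where k: "\<And>x. x \<in> S \<Longrightarrow> k x \<in> K" "\<And>x. x \<in> S \<Longrightarrow> \<exists>\<gamma>\<in>\<Gamma>. \<gamma> (k x 0) = x"
    by metis
  have "inj_on k S"
  proof (rule inj_onI)
    fix x y assume xy: "x \<in> S" "y \<in> S" "k x = k y"
    obtain \<gamma> \<delta> where gd: "\<gamma> \<in> \<Gamma>" "\<gamma> (k x 0) = x" "\<delta> \<in> \<Gamma>" "\<delta> (k x 0) = y"
      using k(2)[OF xy(1)] k(2)[OF xy(2)] xy(3) by metis
    obtain \<gamma>' where g: "\<gamma>' \<in> \<Gamma>" "\<gamma>' \<circ> \<gamma> = id" using Gamma_inverse gd by blast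
    have "(\<delta> \<circ> \<gamma>') x = y" using gd g by (metis comp_apply id_apply)
    then have "\<exists>\<gamma>\<in>\<Gamma>. \<gamma> x = y" using Gamma_comp gd g by blast
    moreover have "\<exists>\<gamma>\<in>\<Gamma>. \<gamma> y = y" using Gamma_id by (metis id_apply)
    ultimately show "x = y" using S xy by blast
  qed
  then show ?thesis using k(1) K(1) inj_on_finite[of k S K] by blast
qed

end

section \<open>Weyl group invariance of weight multiplicities\<close>

lemma matrix_2_mult:
  "(vector [vector [a, b], vector [c, d]] :: 'k::field^2^2) ** (vector [vector [a', b'], vector [c', d']] :: 'k^2^2)
    = vector [vector [a * a' + b * c', a * b' + b * d'], vector [c * a' + d * c', c * b' + d * d']]"
  by (simp add: matrix_matrix_mult_def vec_eq_iff forall_2 sum_2)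

lemma det_2_vector: "det (vector [vector [a, b], vector [c, d]] :: 'k::field^2^2) = a * d - b * c"
  by (simp add: det_2)

text \<open>
  The matrix \<open>((0, z), (-1/z, 0))\<close>, as a product of triangular unipotent matrices. This form makes
  the effect of conjugation by a torus element visible, which scales the arguments of \<open>upper\<close> and
  \<open>lower\<close> by inverse factors.
\<close>

definition weyl_elt :: "'k::field \<Rightarrow> 'k^2^2" where
  "weyl_elt z = upper z ** lower (- inverse z) ** upper z"

lemma weyl_elt_diag: "z \<noteq> 0 \<Longrightarrow> weyl_elt z = diag z ** weyl_elt 1"
  by (simp add: weyl_elt_def upper_def lower_def diag_def matrix_2_mult)

lemma det_upper: "det (upper c) = 1" and det_lower: "det (lower c) = 1"
  and det_diag: "z \<noteq> 0 \<Longrightarrow> det (diag z) = 1"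
  by (simp_all add: upper_def lower_def diag_def det_2_vector)

lemma det_weyl_elt: "det (weyl_elt z) = 1"
  by (simp add: weyl_elt_def det_mul det_upper det_lower)

lemma matrix_inv_left: "invertible A \<Longrightarrow> matrix_inv A ** A = mat 1"
  and matrix_inv_right: "invertible A \<Longrightarrow> A ** matrix_inv A = mat 1"
  for A :: "'k::field^'n^'n"
  using someI_ex[of "\<lambda>A'. A ** A' = mat 1 \<and> A' ** A = mat 1"]
  by (auto simp: invertible_def matrix_inv_def)

lemma subgroup_GL_closed:
  fixes H :: "('k::field^'n^'n) set"
  assumes "subgroup H GL"
  shows "A \<in> H \<Longrightarrow> invertible A" "mat 1 \<in> H" "A \<in> H \<Longrightarrow> B \<in> H \<Longrightarrow> A ** B \<in> H"
    "A \<in> H \<Longrightarrow> matrix_inv A \<in> H"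
proof -
  show inv: "A \<in> H \<Longrightarrow> invertible A" for A using assms by (auto simp: subgroup_def GL_def)
  show "mat 1 \<in> H" "A \<in> H \<Longrightarrow> B \<in> H \<Longrightarrow> A ** B \<in> H" using assms by (auto simp: subgroup_def GL_def)
  assume A: "A \<in> H"
  then have iA: "invertible A" by (rule inv)
  then have iA': "invertible (matrix_inv A)"
    using matrix_inv_left matrix_inv_right unfolding invertible_def by blast
  have "inv\<^bsub>GL\<^esub> A = matrix_inv A"
  proof (unfold m_inv_def, rule the_equality, goal_cases)
    case 1
    then show ?case using iA' matrix_inv_left[OF iA] matrix_inv_right[OF iA] by (simp add: GL_def)
  next
    case (2 B)
    then have "A ** B = mat 1" by (simp add: GL_def)
    then have "matrix_inv A ** A ** B = matrix_inv A" by (simp add: matrix_mul_assoc[symmetric])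
    then show ?case using matrix_inv_left[OF iA] by simp
  qed
  then show "matrix_inv A \<in> H" using assms A by (metis subgroup.m_inv_closed)
qed

lemma has_root_datumD:
  assumes "has_root_datum G T ch L R"
  shows "subgroup G GL" "subgroup T GL" "T \<subseteq> G"
    "x \<in> L \<Longrightarrow> s \<in> T \<Longrightarrow> ch x s \<noteq> 0"
    "x \<in> L \<Longrightarrow> s \<in> T \<Longrightarrow> t \<in> T \<Longrightarrow> ch x (s ** t) = ch x s * ch x t"
    "x \<in> L \<Longrightarrow> y \<in> L \<Longrightarrow> x + y \<in> L \<and> - x \<in> L"
    "x \<in> L \<Longrightarrow> y \<in> L \<Longrightarrow> s \<in> T \<Longrightarrow> ch (x + y) s = ch x s * ch y s"
    "a \<in> R \<Longrightarrow> a \<in> L"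
    "a \<in> R \<Longrightarrow> \<exists>\<phi>. coroot_hom G T L ch a \<phi>"
proof -
  have red: "reductive_group G" and T: "maximal_torus G T"
    and ch: "\<forall>x\<in>L. ch x \<in> characters T"
    and L: "\<forall>x\<in>L. \<forall>y\<in>L. x + y \<in> L \<and> - x \<in> L \<and> (\<forall>t\<in>T. ch (x + y) t = ch x t * ch y t)"
    and R: "R = {a\<in>L. a \<noteq> 0 \<and>
       (\<exists>Z\<in>lie_algebra G. Z \<noteq> 0 \<and> (\<forall>t\<in>T. t ** Z ** matrix_inv t = mat_scale (ch a t) Z))}"
    and \<phi>: "\<forall>a\<in>R. \<exists>\<phi>. coroot_hom G T L ch a \<phi>"
    using assms unfolding has_root_datum_def by - ((elim conjE, assumption)+)
  show "subgroup G GL" using red by (simp add: reductive_group_def closed_subgroup_def)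
  show "subgroup T GL" "T \<subseteq> G"
    using T by (simp_all add: maximal_torus_def alg_torus_def closed_subgroup_def)
  show "x \<in> L \<Longrightarrow> s \<in> T \<Longrightarrow> ch x s \<noteq> 0"
    "x \<in> L \<Longrightarrow> s \<in> T \<Longrightarrow> t \<in> T \<Longrightarrow> ch x (s ** t) = ch x s * ch x t"
    using ch by (simp_all add: characters_def)
  show "x \<in> L \<Longrightarrow> y \<in> L \<Longrightarrow> x + y \<in> L \<and> - x \<in> L"
    "x \<in> L \<Longrightarrow> y \<in> L \<Longrightarrow> s \<in> T \<Longrightarrow> ch (x + y) s = ch x s * ch y s"
    using L by simp_all
  show "a \<in> R \<Longrightarrow> a \<in> L" using R by simp
  show "a \<in> R \<Longrightarrow> \<exists>\<phi>. coroot_hom G T L ch a \<phi>" using \<phi> by simp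
qed

text \<open>
  A representative \<open>n\<close> in the group of the reflection attached to the root \<open>a\<close>: conjugation by the
  image of \<open>((0, 1), (-1, 0))\<close> stabilizes the torus and acts on characters as the reflection.
  Indeed, conjugating \<open>n\<close> by a torus element \<open>t\<close> multiplies it by the value of the coroot at \<open>a(t)\<close>.
\<close>

lemma reflection_representative:
  fixes G T :: "('k::field^'n^'n) set"
  assumes rd: "has_root_datum G T ch L R" and a: "a \<in> R"
  shows "\<exists>n\<in>G. \<forall>s\<in>T. n ** s ** matrix_inv n \<in> T \<and>
    (\<forall>x\<in>L. \<exists>k::int. x \<bullet> coroot a = of_int k \<and>
       ch x (n ** s ** matrix_inv n) = ch x s * inverse (ch a s) powi k)"
proof -
  obtain \<phi> where \<phi>: "coroot_hom G T L ch a \<phi>" using has_root_datumD(9)[OF rd a] by blast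
  note sT = has_root_datumD(2)[OF rd] and sG = has_root_datumD(1)[OF rd]
    and chT = has_root_datumD(4,5)[OF rd] and aL = has_root_datumD(8)[OF rd a]
  have \<phi>G: "\<phi> A \<in> G" if "det A = 1" for A
    using \<phi> that by (auto simp: coroot_hom_def hom_def)
  have \<phi>m: "\<phi> (A ** B) = \<phi> A ** \<phi> B" if "det A = 1" "det B = 1" for A B
    using \<phi> that by (auto simp: coroot_hom_def hom_def GL_def)
  have conj: "t ** \<phi> (upper c) ** matrix_inv t = \<phi> (upper (ch a t * c))"
    "t ** \<phi> (lower c) ** matrix_inv t = \<phi> (lower (inverse (ch a t) * c))" if "t \<in> T" for t c
    using \<phi> that by (auto simp: coroot_hom_def)
  have \<phi>d: "\<phi> (diag z) \<in> T" "x \<bullet> coroot a \<in> \<int>" "ch x (\<phi> (diag z)) = z powi \<lfloor>x \<bullet> coroot a\<rfloor>"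
    if "z \<noteq> 0" "x \<in> L" for z x
    using \<phi> that by (auto simp: coroot_hom_def)
  define n where "n = \<phi> (weyl_elt 1)"
  have nG: "n \<in> G" unfolding n_def by (rule \<phi>G[OF det_weyl_elt])
  have ninv: "n ** matrix_inv n = mat 1" by (rule matrix_inv_right[OF subgroup_GL_closed(1)[OF sG nG]])
  have tn: "t ** n ** matrix_inv t = \<phi> (diag (ch a t)) ** n" if t: "t \<in> T" for t
  proof -
    let ?z = "ch a t"
    have tinv: "matrix_inv t ** t = mat 1"
      by (rule matrix_inv_left[OF subgroup_GL_closed(1)[OF sT t]])
    have z: "?z \<noteq> 0" by (rule chT(1)[OF aL t])
    have n: "n = \<phi> (upper 1) ** \<phi> (lower (- 1)) ** \<phi> (upper 1)"
      by (simp add: n_def weyl_elt_def \<phi>m det_upper det_lower det_mul)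
    have tt: "matrix_inv t ** (t ** B) = B" for B :: "'k^'n^'n"
      using tinv by (simp add: matrix_mul_assoc)
    have "t ** n ** matrix_inv t = (t ** \<phi> (upper 1) ** matrix_inv t) **
        (t ** \<phi> (lower (- 1)) ** matrix_inv t) ** (t ** \<phi> (upper 1) ** matrix_inv t)"
      by (simp add: n tt flip: matrix_mul_assoc)
    also have "\<dots> = \<phi> (weyl_elt ?z)"
      by (simp add: conj[OF t] weyl_elt_def \<phi>m det_upper det_lower det_mul)
    also have "\<dots> = \<phi> (diag ?z) ** n"
      by (simp add: weyl_elt_diag[OF z] \<phi>m det_diag[OF z] det_weyl_elt n_def)
    finally show ?thesis .
  qed
  show ?thesis
  proof (intro bexI[of _ n] ballI conjI nG)
    fix s assume s: "s \<in> T"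
    let ?t = "matrix_inv s"
    have t: "?t \<in> T" by (rule subgroup_GL_closed(4)[OF sT s])
    have invs: "invertible s" by (rule subgroup_GL_closed(1)[OF sT s])
    have ts: "?t ** s = mat 1" "s ** ?t = mat 1"
      by (rule matrix_inv_left[OF invs], rule matrix_inv_right[OF invs])
    have it: "invertible ?t" by (rule subgroup_GL_closed(1)[OF sT t])
    have tt: "matrix_inv ?t = s"
    proof -
      have "matrix_inv ?t = matrix_inv ?t ** (?t ** s)" by (simp add: ts)
      also have "\<dots> = s" using matrix_inv_left[OF it] by (simp add: matrix_mul_assoc)
      finally show ?thesis .
    qed
    have key: "n ** s ** matrix_inv n = s ** \<phi> (diag (ch a ?t))"
    proof -
      have "n ** s = s ** (?t ** n ** s)" by (simp add: matrix_mul_assoc ts)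
      also have "\<dots> = s ** (\<phi> (diag (ch a ?t)) ** n)" using tn[OF t] tt by simp
      finally have "n ** s ** matrix_inv n = s ** \<phi> (diag (ch a ?t)) ** (n ** matrix_inv n)"
        by (simp add: matrix_mul_assoc)
      then show ?thesis by (simp add: ninv)
    qed
    have cat: "ch a ?t = inverse (ch a s)"
    proof -
      have one: "mat 1 \<in> T" by (rule subgroup_GL_closed(2)[OF sT])
      have "ch a (mat 1) = 1" using chT(1)[OF aL one] chT(2)[OF aL one one] by simp
      then have "ch a ?t * ch a s = 1" using chT(2)[OF aL t s] by (simp add: ts)
      then show ?thesis by (metis inverse_unique mult.commute)
    qed
    have z: "ch a ?t \<noteq> 0" by (rule chT(1)[OF aL t])
    show "n ** s ** matrix_inv n \<in> T"
      unfolding key by (rule subgroup_GL_closed(3)[OF sT s \<phi>d(1)[OF z aL]])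
    fix x assume x: "x \<in> L"
    have "ch x (n ** s ** matrix_inv n) = ch x s * inverse (ch a s) powi \<lfloor>x \<bullet> coroot a\<rfloor>"
      unfolding key using chT(2)[OF x s \<phi>d(1)[OF z x]] \<phi>d(3)[OF z x] cat by simp
    moreover have "x \<bullet> coroot a = of_int \<lfloor>x \<bullet> coroot a\<rfloor>" using \<phi>d(2)[OF z x] by (auto elim: Ints_cases)
    ultimately show "\<exists>k::int. x \<bullet> coroot a = of_int k \<and>
       ch x (n ** s ** matrix_inv n) = ch x s * inverse (ch a s) powi k" by blast
  qed
qed

text \<open>With \<open>x = a\<close> and exponent \<open>- k\<close>, this identifies the right-hand side of the formula above as the value
  at \<open>s\<close> of the character that belongs to the reflected weight.\<close>

lemma character_scaleR_of_int:
  assumes rd: "has_root_datum G T ch L R" and x: "x \<in> L" and s: "s \<in> T"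
  shows "of_int k *\<^sub>R x \<in> L \<and> ch (of_int k *\<^sub>R x) s = ch x s powi k"
proof -
  have L: "x + y \<in> L" "- x \<in> L" "ch (x + y) s = ch x s * ch y s" if "x \<in> L" "y \<in> L" for x y
    using has_root_datumD(6,7)[OF rd] that s by blast+
  have nz: "ch y s \<noteq> 0" if "y \<in> L" for y
    using has_root_datumD(4)[OF rd] that s by blast
  have L0: "0 \<in> L" using L(1)[OF x L(2)[OF x x]] by simp
  have ch0: "ch 0 s = 1" using L(3)[OF L0 L0] nz[OF L0] by simp
  have chm: "ch (- x) s = inverse (ch x s)"
    using L(3)[OF x L(2)[OF x x]] ch0 by (metis inverse_unique add.right_inverse)
  show ?thesis
  proof (induction k rule: int_induct[where k = 0])
    case base
    then show ?case using L0 ch0 by simp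
  next
    case (step1 i)
    then show ?case using L(1,3)[of "of_int i *\<^sub>R x" x] x nz[OF x]
      by (simp add: scaleR_add_left power_int_add)
  next
    case (step2 i)
    then show ?case using L(1,3)[of "of_int i *\<^sub>R x" "- x"] L(2)[OF x x] nz[OF x] chm
      by (simp add: scaleR_diff_left power_int_diff field_simps)
  qed
qed

text \<open>
  The image under \<open>\<pi>\<close> of the inverse of the representative maps a weight space injectively into the
  weight space of the reflected weight.
\<close>

lemma (in rootsys) weight_mult_refl_le:
  fixes Gd Td :: "('k::field^'m^'m) set" and \<pi> :: "'k^'m^'m \<Rightarrow> 'k^'d^'d"
  assumes rd: "has_root_datum Gd Td ch coweights (coroot ` \<Phi>)"
    and hom: "\<pi> \<in> hom (as_group Gd) GL"
    and \<alpha>: "\<alpha> \<in> \<Phi>" and l: "l \<in> coweights"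
  shows "weight_mult Td ch \<pi> l \<le> weight_mult Td ch \<pi> (refl \<alpha> l)"
proof -
  note sG = has_root_datumD(1)[OF rd] and TG = has_root_datumD(3)[OF rd]
  have \<pi>m: "\<pi> (A ** B) = \<pi> A ** \<pi> B" if "A \<in> Gd" "B \<in> Gd" for A B
    using hom that by (auto simp: hom_def GL_def)
  have \<pi>i: "invertible (\<pi> A)" if "A \<in> Gd" for A
    using hom that by (auto simp: hom_def GL_def)
  have a: "coroot \<alpha> \<in> coroot ` \<Phi>" and aL: "coroot \<alpha> \<in> coweights"
    using \<alpha> coroot_in_coroots coroots_subset_coweights by auto
  obtain n where n: "n \<in> Gd" and conj: "\<And>s. s \<in> Td \<Longrightarrow> n ** s ** matrix_inv n \<in> Td"
    and ch: "\<And>s x. s \<in> Td \<Longrightarrow> x \<in> coweights \<Longrightarrow> \<exists>k::int. x \<bullet> coroot (coroot \<alpha>) = of_int k \<and>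
       ch x (n ** s ** matrix_inv n) = ch x s * inverse (ch (coroot \<alpha>) s) powi k"
    using reflection_representative[OF rd a] by blast
  let ?n = "matrix_inv n"
  have n': "?n \<in> Gd" by (rule subgroup_GL_closed(4)[OF sG n])
  have chs: "ch l (n ** s ** ?n) = ch (refl \<alpha> l) s" if s: "s \<in> Td" for s
  proof -
    obtain k :: int where k: "l \<bullet> coroot (coroot \<alpha>) = of_int k"
      "ch l (n ** s ** ?n) = ch l s * inverse (ch (coroot \<alpha>) s) powi k" using ch[OF s l] by blast
    have r: "refl \<alpha> l = l + of_int (- k) *\<^sub>R coroot \<alpha>"
      using k(1) coroot_coroot[OF root_nonzero[OF \<alpha>]] by (simp add: refl_def inner_commute)
    note m = character_scaleR_of_int[OF rd aL s, of "- k"]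
    have "ch (refl \<alpha> l) s = ch l s * ch (coroot \<alpha>) s powi (- k)"
      unfolding r using has_root_datumD(7)[OF rd l _ s] m by metis
    then show ?thesis using k(2) by (simp add: power_int_minus power_int_inverse)
  qed
  have sub: "(*v) (\<pi> ?n) ` {x. \<forall>t\<in>Td. \<pi> t *v x = ch l t *s x}
      \<subseteq> {x. \<forall>t\<in>Td. \<pi> t *v x = ch (refl \<alpha> l) t *s x}"
  proof (clarsimp)
    fix x s assume x: "\<forall>t\<in>Td. \<pi> t *v x = ch l t *s x" and s: "s \<in> Td"
    have sG': "s \<in> Gd" using s TG by blast
    have inv: "?n ** n = mat 1" by (rule matrix_inv_left[OF subgroup_GL_closed(1)[OF sG n]])
    have "s ** ?n = ?n ** (n ** s ** ?n)" by (simp add: matrix_mul_assoc inv)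
    then have "\<pi> s ** \<pi> ?n = \<pi> ?n ** \<pi> (n ** s ** ?n)"
      using \<pi>m[OF sG' n'] \<pi>m[OF n' subsetD[OF TG conj[OF s]]] by simp
    then have "\<pi> s *v (\<pi> ?n *v x) = \<pi> ?n *v (\<pi> (n ** s ** ?n) *v x)"
      by (simp add: matrix_vector_mul_assoc)
    also have "\<dots> = \<pi> ?n *v (ch l (n ** s ** ?n) *s x)" using x conj[OF s] by simp
    finally show "\<pi> s *v (\<pi> ?n *v x) = ch (refl \<alpha> l) s *s (\<pi> ?n *v x)"
      by (simp add: chs[OF s] vec.scale)
  qed
  have inj: "inj ((*v) (\<pi> ?n))"
  proof (rule injI)
    fix x y assume "\<pi> ?n *v x = \<pi> ?n *v y"
    then have "matrix_inv (\<pi> ?n) *v (\<pi> ?n *v x) = matrix_inv (\<pi> ?n) *v (\<pi> ?n *v y)" by simp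
    then show "x = y" by (simp add: matrix_vector_mul_assoc matrix_inv_left[OF \<pi>i[OF n']])
  qed
  have lin: "Vector_Spaces.linear (*s) (*s) ((*v) (\<pi> ?n))" by (rule matrix_vector_mul_linear_gen)
  have "weight_mult Td ch \<pi> l = vec.dim ((*v) (\<pi> ?n) ` {x. \<forall>t\<in>Td. \<pi> t *v x = ch l t *s x})"
    unfolding weight_mult_def by (rule vec.dim_image_eq[OF lin inj_on_subset[OF inj subset_UNIV], symmetric])
  also have "\<dots> \<le> weight_mult Td ch \<pi> (refl \<alpha> l)"
    unfolding weight_mult_def by (rule vec.dim_subset[OF sub])
  finally show ?thesis .
qed

lemma (in rootsys) weight_mult_weyl:
  assumes rd: "has_root_datum Gd Td ch coweights (coroot ` \<Phi>)"
    and hom: "\<pi> \<in> hom (as_group Gd) GL"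
    and w: "w \<in> W" and l: "l \<in> coweights"
  shows "weight_mult Td ch \<pi> (w l) = weight_mult Td ch \<pi> l"
  using w
proof (induction rule: weyl.induct)
  case (refl \<alpha> w)
  have wl: "w l \<in> coweights" "refl \<alpha> (w l) \<in> coweights"
    using weyl_coweights refl l refl_in_weyl by blast+
  show ?case
    using weight_mult_refl_le[OF rd hom refl(1) wl(1)] weight_mult_refl_le[OF rd hom refl(1) wl(2)]
      refl_refl[OF root_nonzero[OF refl(1)]] refl.IH by simp
qed simp

text \<open>
  The multiset of weights is a sum over the set of weights, which is empty by convention if that set
  is infinite; a nonempty value shows that it is finite.
\<close>

lemma count_wt:
  assumes "wt Td ch \<Phi> \<pi> \<noteq> {#}"
  shows "count (wt Td ch \<Phi> \<pi>) l = (if l \<in> coweight_lattice \<Phi> then weight_mult Td ch \<pi> l else 0)"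
proof -
  let ?A = "{l\<in>coweight_lattice \<Phi>. weight_mult Td ch \<pi> l \<noteq> 0}"
  have fin: "finite ?A" using assms by (auto simp: wt_def intro: ccontr)
  have "count (wt Td ch \<Phi> \<pi>) l = (\<Sum>m\<in>?A. if l = m then weight_mult Td ch \<pi> m else 0)"
    by (auto simp: wt_def count_sum intro!: sum.cong)
  then show ?thesis using fin by (auto simp: sum.delta')
qed

lemma count_image_mset_inj: "inj f \<Longrightarrow> count (image_mset f M) (f x) = count M x"
  by (induction M) (auto simp: inj_eq)

lemma (in rootsys) image_wt'_weyl:
  assumes rd: "has_root_datum Gd Td ch coweights (coroot ` \<Phi>)"
    and hom: "\<pi> \<in> hom (as_group Gd) GL"
    and ne: "wt Td ch \<Phi> \<pi> \<noteq> {#}" and w: "w \<in> W"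
  shows "image_mset w (wt' Td ch \<Phi> \<pi>) = wt' Td ch \<Phi> \<pi>"
proof (rule multiset_eqI)
  fix x
  obtain w' where w': "w' \<in> W" "w \<circ> w' = id" using weyl_inverse[OF w] by blast
  define y where "y = w' x"
  have x: "x = w y" using w'(2) by (metis comp_apply id_apply y_def)
  have yx: "x \<in> coweights \<longleftrightarrow> y \<in> coweights"
    using x weyl_coweights[OF w] weyl_coweights[OF w'(1)] y_def by metis
  have "x = 0 \<longleftrightarrow> y = 0"
    using x weyl_zero[OF w] weyl_inj[OF w] by (metis injD)
  moreover have "weight_mult Td ch \<pi> x = weight_mult Td ch \<pi> y" if "y \<in> coweights"
    using weight_mult_weyl[OF rd hom w that] x by simp
  ultimately have "count (wt' Td ch \<Phi> \<pi>) y = count (wt' Td ch \<Phi> \<pi>) x"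
    using yx by (simp add: wt'_def count_wt[OF ne])
  then show "count (image_mset w (wt' Td ch \<Phi> \<pi>)) x = count (wt' Td ch \<Phi> \<pi>) x"
    unfolding x by (simp add: count_image_mset_inj[OF weyl_inj[OF w]])
qed

section \<open>Spherical vectors and translation operators\<close>

lemma sum_mset_sum_swap:
  "(\<Sum>l\<in>#M. \<Sum>i\<in>I. h l i) = (\<Sum>i\<in>I. \<Sum>l\<in>#M. h l i)"
  for h :: "'b \<Rightarrow> 'c \<Rightarrow> 'd::comm_monoid_add"
  by (induction M) (simp_all add: sum.distrib)

text \<open>Vectors fixed by the finite Weyl group, which is the stabilizer of the vertex \<open>0\<close> in
  the extended affine Weyl group.\<close>

definition weyl_fixed :: "'a::euclidean_space set \<Rightarrow> (('a \<Rightarrow> 'a) \<Rightarrow> complex) \<Rightarrow> bool" where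
  "weyl_fixed \<Phi> f \<longleftrightarrow> (\<forall>w\<in>weyl \<Phi>. rtrans w f = f)"

text \<open>
  The operator that sums right translates over a multiset of lattice vectors. On functions fixed by
  the Weyl group, and for a multiset stable under it, this is a Hecke operator.
\<close>

definition translation_sum ::
  "'a::euclidean_space multiset \<Rightarrow> (('a \<Rightarrow> 'a) \<Rightarrow> complex) \<Rightarrow> ('a \<Rightarrow> 'a) \<Rightarrow> complex" where
  "translation_sum M f = (\<lambda>g. \<Sum>l\<in>#M. f (g \<circ> transl l))"

text \<open>Multisets of coweights, with multiplicities invariant under the Weyl group.\<close>

definition weyl_stable :: "'a::euclidean_space set \<Rightarrow> 'a multiset \<Rightarrow> bool" where
  "weyl_stable \<Phi> M \<longleftrightarrow> set_mset M \<subseteq> coweight_lattice \<Phi> \<and> (\<forall>w\<in>weyl \<Phi>. image_mset w M = M)"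

context rootsys begin

lemma weyl_fixedD: "weyl_fixed \<Phi> f \<Longrightarrow> w \<in> W \<Longrightarrow> f (g \<circ> w) = f g"
  unfolding weyl_fixed_def rtrans_def by metis

lemma Wext_comp_transl_iff:
  assumes "l \<in> coweights"
  shows "g \<circ> transl l \<in> Wext \<longleftrightarrow> g \<in> Wext"
proof
  assume "g \<circ> transl l \<in> Wext"
  then have "(g \<circ> transl l) \<circ> transl (- l) \<in> Wext"
    using Wext_comp transl_in_Wext[OF coweights_minus[OF assms]] by blast
  then show "g \<in> Wext" by (simp add: comp_def)
qed (use Wext_comp transl_in_Wext[OF assms] in blast)

lemma Wext_comp_weyl_iff:
  assumes "w \<in> W"
  shows "g \<circ> w \<in> Wext \<longleftrightarrow> g \<in> Wext"
proof
  assume gw: "g \<circ> w \<in> Wext"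
  obtain w' where w': "w' \<in> W" "w \<circ> w' = id" using weyl_inverse assms by blast
  have "(g \<circ> w) \<circ> w' \<in> Wext" using Wext_comp gw w'(1) weyl_subset_Wext by blast
  then show "g \<in> Wext" by (simp only: comp_assoc w'(2) comp_id)
qed (use Wext_comp assms weyl_subset_Wext in blast)

lemma character_zero: "lattice_character coweights \<xi> \<Longrightarrow> \<xi> 0 = 1"
  unfolding lattice_character_def using coweights_zero by (metis add_0 mult_cancel_right1)

lemma character_nat:
  assumes "lattice_character coweights \<xi>" "l \<in> coweights"
  shows "\<xi> (real n *\<^sub>R l) = \<xi> l ^ n"
proof (induction n)
  case (Suc n)
  have "\<xi> (real (Suc n) *\<^sub>R l) = \<xi> (l + real n *\<^sub>R l)" by (simp add: scaleR_add_left)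
  then show ?case using assms coweights_nat[OF assms(2)] Suc by (simp add: lattice_character_def)
qed (use character_zero assms in simp)

lemma weyl_stable_scale:
  assumes "weyl_stable \<Phi> M"
  shows "weyl_stable \<Phi> (image_mset (\<lambda>l. real n *\<^sub>R l) M)"
proof -
  have "image_mset w (image_mset (\<lambda>l. real n *\<^sub>R l) M) = image_mset (\<lambda>l. real n *\<^sub>R l) M"
    if "w \<in> W" for w
  proof -
    have "image_mset w (image_mset (\<lambda>l. real n *\<^sub>R l) M) = image_mset (\<lambda>l. real n *\<^sub>R l) (image_mset w M)"
      by (simp add: multiset.map_comp comp_def linear_scale[OF weyl_linear[OF that]])
    then show ?thesis using assms that by (simp add: weyl_stable_def)
  qed
  then show ?thesis using assms coweights_nat by (auto simp: weyl_stable_def)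
qed

text \<open>An induced representation has, up to scalars, only one vector fixed by the Weyl group.\<close>

lemma Ind_weyl_fixed:
  assumes "F \<in> Ind \<Phi> \<xi>" "weyl_fixed \<Phi> F" "l \<in> coweights" "w \<in> W"
  shows "F (transl l \<circ> w) = \<xi> l * F id"
proof -
  have "F (transl l \<circ> w) = \<xi> l * F w"
    using assms(1,3) subsetD[OF weyl_subset_Wext assms(4)] by (simp add: Ind_def)
  also have "F w = F id" using weyl_fixedD[OF assms(2,4), of id] by simp
  finally show ?thesis .
qed

lemma Ind_weyl_fixed_eq_zero:
  assumes "F \<in> Ind \<Phi> \<xi>" "weyl_fixed \<Phi> F" "F id = 0"
  shows "F = (\<lambda>_. 0)"
proof
  fix g show "F g = 0"
  proof (cases "g \<in> Wext")
    case True
    then obtain w l where "w \<in> W" "l \<in> coweights" "g = transl l \<circ> w" by (rule Wext_E)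
    then show ?thesis using Ind_weyl_fixed[OF assms(1,2)] assms(3) by simp
  qed (use assms(1) in \<open>simp add: Ind_def\<close>)
qed

text \<open>
  Moving a Weyl group element past a translation permutes the multiset, so the spherical vector is an
  eigenvector.
\<close>

lemma Ind_translation_sum:
  assumes F: "F \<in> Ind \<Phi> \<xi>" "weyl_fixed \<Phi> F" and \<xi>: "lattice_character coweights \<xi>"
    and M: "weyl_stable \<Phi> M"
  shows "translation_sum M F = (\<lambda>g. (\<Sum>l\<in>#M. \<xi> l) * F g)"
proof
  fix g
  have M': "l \<in> coweights" if "l \<in># M" for l using M that by (auto simp: weyl_stable_def)
  show "translation_sum M F g = (\<Sum>l\<in>#M. \<xi> l) * F g"
  proof (cases "g \<in> Wext")
    case True
    then obtain w m where g: "w \<in> W" "m \<in> coweights" "g = transl m \<circ> w" by (rule Wext_E)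
    have "F (g \<circ> transl l) = \<xi> (w l) * F g" if "l \<in># M" for l
    proof -
      have wl: "w l \<in> coweights" using weyl_coweights g(1) M' that by blast
      have "g \<circ> transl l = transl (m + w l) \<circ> w"
        using affine_comp[OF g(1), of m l id] by (simp add: g(3))
      then have "F (g \<circ> transl l) = \<xi> (m + w l) * F id"
        using Ind_weyl_fixed[OF F coweights_add[OF g(2) wl] g(1)] by simp
      also have "\<dots> = \<xi> (w l) * (\<xi> m * F id)"
        using \<xi> g(2) wl by (simp add: lattice_character_def)
      finally show ?thesis using Ind_weyl_fixed[OF F g(2,1)] by (simp add: g(3))
    qed
    then have "translation_sum M F g = (\<Sum>l\<in>#M. \<xi> (w l) * F g)"
      unfolding translation_sum_def by (intro arg_cong[of _ _ sum_mset] image_mset_cong)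
    also have "\<dots> = (\<Sum>l\<in>#image_mset w M. \<xi> l) * F g"
      by (simp add: sum_mset_distrib_right multiset.map_comp comp_def)
    also have "image_mset w M = M" using M g(1) by (simp add: weyl_stable_def)
    finally show ?thesis .
  next
    case False
    then have "F (g \<circ> transl l) = 0" if "l \<in># M" for l
      using F(1) Wext_comp_transl_iff[OF M'[OF that]] by (simp add: Ind_def)
    then have "translation_sum M F g = (\<Sum>l\<in>#M. 0)"
      unfolding translation_sum_def by (intro arg_cong[of _ _ sum_mset] image_mset_cong)
    then show ?thesis using False F(1) by (simp add: Ind_def)
  qed
qed

lemma subrep_scale:
  assumes "subrep \<Phi> N \<rho>" "f \<in> \<rho>"
  shows "(\<lambda>g. a * f g) \<in> \<rho>"
proof -
  have "(\<lambda>g. a * f g + 0 * f g) \<in> \<rho>" using assms unfolding subrep_def by blast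
  then show ?thesis by simp
qed

end

text \<open>
  A representation \<open>\<rho>\<close> with an equivariant embedding \<open>\<theta>\<close> into the representation induced from \<open>\<xi>\<close>,
  which transports the computations above to \<open>\<rho>\<close>.
\<close>

locale induced_embedding = rootsys \<Phi> for \<Phi> :: "'a::euclidean_space set" +
  fixes \<xi> :: "'a \<Rightarrow> complex" and N \<rho> :: "(('a \<Rightarrow> 'a) \<Rightarrow> complex) set"
    and \<theta> :: "(('a \<Rightarrow> 'a) \<Rightarrow> complex) \<Rightarrow> ('a \<Rightarrow> 'a) \<Rightarrow> complex"
  assumes character: "lattice_character (coweight_lattice \<Phi>) \<xi>"
    and subrep: "subrep \<Phi> N \<rho>"
    and inj: "inj_on \<theta> \<rho>"
    and ind: "f \<in> \<rho> \<Longrightarrow> \<theta> f \<in> Ind \<Phi> \<xi>"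
    and lin: "f \<in> \<rho> \<Longrightarrow> f' \<in> \<rho> \<Longrightarrow> \<theta> (\<lambda>g. a * f g + b * f' g) = (\<lambda>g. a * \<theta> f g + b * \<theta> f' g)"
    and equi: "h \<in> ext_affine_weyl \<Phi> \<Longrightarrow> f \<in> \<rho> \<Longrightarrow> \<theta> (rtrans h f) = rtrans h (\<theta> f)"
begin

lemma scale:
  assumes "f \<in> \<rho>"
  shows "\<theta> (\<lambda>g. a * f g) = (\<lambda>g. a * \<theta> f g)"
  using lin[OF assms assms, of a 0] by simp

lemma fixed:
  assumes "f \<in> \<rho>" "weyl_fixed \<Phi> f"
  shows "weyl_fixed \<Phi> (\<theta> f)"
  unfolding weyl_fixed_def
proof
  fix w assume w: "w \<in> W"
  have "rtrans w (\<theta> f) = \<theta> (rtrans w f)"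
    by (rule equi[OF subsetD[OF weyl_subset_Wext w] assms(1), symmetric])
  also have "rtrans w f = f" using assms(2) w by (simp add: weyl_fixed_def)
  finally show "rtrans w (\<theta> f) = \<theta> f" .
qed

lemma nonzero:
  assumes "f \<in> \<rho>" "weyl_fixed \<Phi> f" "f \<noteq> (\<lambda>_. 0)"
  shows "\<theta> f id \<noteq> 0"
proof
  have zero: "(\<lambda>_. 0) \<in> \<rho>" using subrep by (simp add: subrep_def)
  assume "\<theta> f id = 0"
  then have "\<theta> f = (\<lambda>_. 0)"
    by (rule Ind_weyl_fixed_eq_zero[OF ind[OF assms(1)] fixed[OF assms(1,2)]])
  also have "\<dots> = \<theta> (\<lambda>_. 0)" using scale[OF zero, of 0] by simp
  finally show False using inj assms(1,3) zero by (auto dest: inj_onD)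
qed

lemma weyl_fixed_unique:
  assumes f: "f \<in> \<rho>" "weyl_fixed \<Phi> f" "f \<noteq> (\<lambda>_. 0)" and f': "f' \<in> \<rho>" "weyl_fixed \<Phi> f'"
  shows "\<exists>c. f' = (\<lambda>g. c * f g)"
proof -
  define c where "c = \<theta> f' id / \<theta> f id"
  let ?h = "\<lambda>g. 1 * f' g + (- c) * f g"
  have h: "?h \<in> \<rho>" using subrep f(1) f'(1) unfolding subrep_def by blast
  have hw: "weyl_fixed \<Phi> ?h"
    unfolding weyl_fixed_def rtrans_def using weyl_fixedD[OF f(2)] weyl_fixedD[OF f'(2)] by simp
  have "\<theta> ?h id = 0"
    unfolding lin[OF f'(1) f(1)] using nonzero[OF f] by (simp add: c_def)
  then have "?h = (\<lambda>_. 0)" using nonzero[OF h hw] by blast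
  then have "f' g = c * f g" for g by (drule_tac x = g in fun_cong) simp
  then show ?thesis by blast
qed

lemma translation_sum_eigenvector:
  assumes f: "f \<in> \<rho>" "weyl_fixed \<Phi> f" and M: "weyl_stable \<Phi> M"
  shows "translation_sum M f = (\<lambda>g. (\<Sum>l\<in>#M. \<xi> l) * f g)"
proof -
  have "translation_sum M f \<in> \<rho> \<and> \<theta> (translation_sum M f) = translation_sum M (\<theta> f)"
    if "set_mset M \<subseteq> coweights" for M
    using that
  proof (induction M)
    case empty
    show ?case using subrep_scale[OF subrep f(1), of 0] scale[OF f(1), of 0]
      by (simp add: translation_sum_def)
  next
    case (add l M)
    have l: "transl l \<in> Wext" using add.prems transl_in_Wext by simp
    have IH: "translation_sum M f \<in> \<rho>" "\<theta> (translation_sum M f) = translation_sum M (\<theta> f)"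
      using add by auto
    have r: "rtrans (transl l) f \<in> \<rho>" using subrep f(1) l unfolding subrep_def by blast
    have eq: "translation_sum (add_mset l M) h =
        (\<lambda>g. 1 * rtrans (transl l) h g + 1 * translation_sum M h g)" for h
      by (simp add: translation_sum_def rtrans_def)
    have "translation_sum (add_mset l M) f \<in> \<rho>"
      unfolding eq using subrep r IH(1) unfolding subrep_def by blast
    moreover have "\<theta> (translation_sum (add_mset l M) f) = translation_sum (add_mset l M) (\<theta> f)"
      unfolding eq lin[OF r IH(1)] equi[OF l f(1)] IH(2) ..
    ultimately show ?case by blast
  qed
  then have A: "translation_sum M f \<in> \<rho>" "\<theta> (translation_sum M f) = translation_sum M (\<theta> f)"
    using M by (auto simp: weyl_stable_def)
  have "\<theta> (translation_sum M f) = \<theta> (\<lambda>g. (\<Sum>l\<in>#M. \<xi> l) * f g)"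
    unfolding A(2) scale[OF f(1)]
    by (rule Ind_translation_sum[OF ind[OF f(1)] fixed[OF f] character M])
  then show ?thesis using inj A(1) subrep_scale[OF subrep f(1)] by (auto dest: inj_onD)
qed


end

lemma (in rootsys) has_character_embedding:
  assumes "has_character \<Phi> \<rho> \<xi>" and "subrep \<Phi> N \<rho>"
  shows "\<exists>\<theta>. induced_embedding \<Phi> \<xi> N \<rho> \<theta>"
proof -
  obtain U where U: "irreducible_subrep \<Phi> (Ind \<Phi> \<xi>) U" "rep_iso \<Phi> \<rho> U"
    using assms(1) by (auto simp: has_character_def)
  obtain \<theta> where bij: "bij_betw \<theta> \<rho> U"
    and lin: "\<forall>f\<in>\<rho>. \<forall>f'\<in>\<rho>. \<forall>a b. \<theta> (\<lambda>g. a * f g + b * f' g) = (\<lambda>g. a * \<theta> f g + b * \<theta> f' g)"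
    and equi: "\<forall>h\<in>Wext. \<forall>f\<in>\<rho>. \<theta> (rtrans h f) = rtrans h (\<theta> f)"
    using U(2) unfolding rep_iso_def by (elim exE conjE)
  have "\<theta> f \<in> Ind \<Phi> \<xi>" if "f \<in> \<rho>" for f
    using bij_betwE[OF bij] that U(1) by (auto simp: irreducible_subrep_def subrep_def)
  then have "induced_embedding \<Phi> \<xi> N \<rho> \<theta>"
    using assms lin equi bij_betw_imp_inj_on[OF bij] by unfold_locales (auto simp: has_character_def)
  then show ?thesis by blast
qed

context affine_subgroup begin

lemma Gamma_translation_nat:
  assumes "transl x \<in> \<Gamma>"
  shows "transl (real j *\<^sub>R x) \<in> \<Gamma>"
proof (induction j)
  case 0
  then show ?case using Gamma_id by (simp add: id_def)
next
  case (Suc j)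
  have "transl (real (Suc j) *\<^sub>R x) = transl x \<circ> transl (real j *\<^sub>R x)"
    by (rule ext) (simp add: scaleR_add_left)
  then show ?case using Gamma_comp[OF assms Suc] by simp
qed

text \<open>
  Moving the translation by \<open>l\<close> to the left of an element of the extended group replaces \<open>l\<close> by a
  vector in its Weyl orbit; the exponent must therefore serve all of this finite orbit.
\<close>

lemma L2_translation_trivial:
  assumes l: "l \<in> coweights"
  shows "\<exists>k>0. \<forall>f\<in>L2 \<Phi> \<Gamma>. rtrans (transl (real k *\<^sub>R l)) f = f"
proof -
  have "\<forall>w\<in>W. \<exists>k>0. transl (real k *\<^sub>R w l) \<in> \<Gamma>"
    using Gamma_translation_multiple weyl_coweights l by blast
  then obtain k where k: "\<And>w. w \<in> W \<Longrightarrow> k w > 0" "\<And>w. w \<in> W \<Longrightarrow> transl (real (k w) *\<^sub>R w l) \<in> \<Gamma>"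
    by metis
  define n where "n = (\<Prod>w\<in>W. k w)"
  have n: "n > 0" unfolding n_def using k(1) by (simp add: prod_pos)
  have \<Gamma>: "transl (real n *\<^sub>R w l) \<in> \<Gamma>" if w: "w \<in> W" for w
  proof -
    obtain j where j: "n = k w * j" using dvd_prodI[OF finite_weyl w, of k] unfolding n_def dvd_def by blast
    show ?thesis using Gamma_translation_nat[OF k(2)[OF w], of j] by (simp add: j mult.commute)
  qed
  have nl: "real n *\<^sub>R l \<in> coweights" by (rule coweights_nat[OF l])
  have "rtrans (transl (real n *\<^sub>R l)) f = f" if f: "f \<in> L2 \<Phi> \<Gamma>" for f
  proof
    fix g show "rtrans (transl (real n *\<^sub>R l)) f g = f g"
    proof (cases "g \<in> Wext")
      case True
      then obtain w m where g: "w \<in> W" "m \<in> coweights" "g = transl m \<circ> w" by (rule Wext_E)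
      have "g \<circ> transl (real n *\<^sub>R l) = transl (real n *\<^sub>R w l) \<circ> g"
        by (rule ext) (simp add: g(3) linear_add[OF weyl_linear[OF g(1)]]
            linear_scale[OF weyl_linear[OF g(1)]])
      then show ?thesis using f \<Gamma>[OF g(1)] True by (simp add: rtrans_def L2_def)
    next
      case False
      then show ?thesis using f Wext_comp_transl_iff[OF nl] by (simp add: rtrans_def L2_def)
    qed
  qed
  then show ?thesis using n by blast
qed

text \<open>
  The characters that occur in \<open>L2\<close> are unitary: they have finite order, because every lattice
  vector has a positive multiple that acts trivially.
\<close>

lemma norm_character:
  assumes \<rho>: "has_character \<Phi> \<rho> \<xi>" "subrep \<Phi> (L2 \<Phi> \<Gamma>) \<rho>" "unramified \<Phi> \<rho>"
    and l: "l \<in> coweights"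
  shows "norm (\<xi> l) = 1"
proof -
  obtain \<theta> where "induced_embedding \<Phi> \<xi> (L2 \<Phi> \<Gamma>) \<rho> \<theta>"
    using has_character_embedding[OF \<rho>(1,2)] by blast
  then interpret induced_embedding \<Phi> \<xi> "L2 \<Phi> \<Gamma>" \<rho> \<theta> .
  obtain f where f: "f \<in> \<rho>" "weyl_fixed \<Phi> f" "f \<noteq> (\<lambda>_. 0)"
    using \<rho>(3) by (auto simp: unramified_def weyl_fixed_def)
  obtain k where k: "k > 0" "\<forall>f\<in>L2 \<Phi> \<Gamma>. rtrans (transl (real k *\<^sub>R l)) f = f"
    using L2_translation_trivial[OF l] by blast
  have kl: "real k *\<^sub>R l \<in> coweights" by (rule coweights_nat[OF l])
  have "f \<in> L2 \<Phi> \<Gamma>" using f(1) \<rho>(2) by (auto simp: subrep_def)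
  then have "rtrans (transl (real k *\<^sub>R l)) (\<theta> f) = \<theta> f"
    using k(2) equi[OF transl_in_Wext[OF kl] f(1)] by simp
  then have "\<theta> f (transl (real k *\<^sub>R l)) = \<theta> f id"
    by (metis rtrans_def id_comp)
  then have "\<xi> (real k *\<^sub>R l) * \<theta> f id = \<theta> f id"
    using Ind_weyl_fixed[OF ind[OF f(1)] fixed[OF f(1,2)] kl weyl.id] by simp
  then have "\<xi> l ^ k = 1"
    using nonzero[OF f] character_nat[OF character l] by simp
  then have "norm (\<xi> l) ^ k = 1 ^ k" by (simp flip: norm_power)
  then show ?thesis by (rule power_eq_imp_eq_base) (use k(1) in auto)
qed

end

section \<open>The trace formula\<close>

text \<open>
  Here \<open>S\<close> represents the hyperspecial vertices modulo \<open>\<Gamma>\<close>, and \<open>D\<close> is a decomposition of \<open>L2\<close> into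
  irreducibles, whose unramified members \<open>\<rho>\<close> have the character \<open>\<xi> \<rho>\<close>.
\<close>

locale spectral = affine_subgroup \<Phi> \<Gamma> for \<Phi> :: "'a::euclidean_space set" and \<Gamma> +
  fixes S :: "'a set" and D :: "(('a \<Rightarrow> 'a) \<Rightarrow> complex) set set"
    and \<xi> :: "(('a \<Rightarrow> 'a) \<Rightarrow> complex) set \<Rightarrow> 'a \<Rightarrow> complex"
  assumes reps: "orbit_reps \<Gamma> (coweight_lattice \<Phi>) S"
    and decomposition: "irr_decomposition \<Phi> (L2 \<Phi> \<Gamma>) D"
    and characters: "\<forall>\<rho>\<in>{\<rho>\<in>D. unramified \<Phi> \<rho>}. has_character \<Phi> \<rho> (\<xi> \<rho>)"
begin

text \<open>The unramified constituents.\<close>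

definition Unr :: "(('a \<Rightarrow> 'a) \<Rightarrow> complex) set set" where
  "Unr = {\<rho>\<in>D. unramified \<Phi> \<rho>}"

lemma finite_D: "finite D" and finite_Unr: "finite Unr" and Unr_subset: "Unr \<subseteq> D"
  using decomposition by (auto simp: irr_decomposition_def Unr_def)

lemma D_subrep: "\<rho> \<in> D \<Longrightarrow> subrep \<Phi> (L2 \<Phi> \<Gamma>) \<rho>"
  using decomposition by (auto simp: irr_decomposition_def irreducible_subrep_def)

lemma Unr_character: "\<rho> \<in> Unr \<Longrightarrow> has_character \<Phi> \<rho> (\<xi> \<rho>)"
  using characters by (auto simp: Unr_def)

lemma Unr_norm_character: "\<rho> \<in> Unr \<Longrightarrow> l \<in> coweights \<Longrightarrow> norm (\<xi> \<rho> l) = 1"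
  using norm_character[OF Unr_character D_subrep] by (auto simp: Unr_def)

lemma finite_S: "finite S"
  by (rule finite_orbit_reps[OF reps])

lemma S_coweights: "x \<in> S \<Longrightarrow> x \<in> coweights"
  using reps by (auto simp: orbit_reps_def)

lemma S_unique: "x \<in> S \<Longrightarrow> y \<in> S \<Longrightarrow> \<gamma> \<in> \<Gamma> \<Longrightarrow> \<gamma> x = y \<Longrightarrow> x = y"
  using reps S_coweights[of y] Gamma_id unfolding orbit_reps_def by (metis id_apply)

lemma S_representative:
  assumes "l \<in> coweights"
  obtains x \<gamma> where "x \<in> S" "\<gamma> \<in> \<Gamma>" "\<gamma> x = l"
  using reps assms unfolding orbit_reps_def by metis

text \<open>
  A nonzero Weyl-fixed vector in the unramified constituent \<open>\<rho>\<close>; by uniqueness it spans the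
  Weyl-fixed vectors of \<open>\<rho>\<close>.
\<close>

definition sph :: "(('a \<Rightarrow> 'a) \<Rightarrow> complex) set \<Rightarrow> ('a \<Rightarrow> 'a) \<Rightarrow> complex" where
  "sph \<rho> = (SOME f. f \<in> \<rho> \<and> weyl_fixed \<Phi> f \<and> f \<noteq> (\<lambda>_. 0))"

lemma sph:
  assumes "\<rho> \<in> Unr"
  shows "sph \<rho> \<in> \<rho>" "weyl_fixed \<Phi> (sph \<rho>)" "sph \<rho> \<noteq> (\<lambda>_. 0)"
proof -
  have "\<exists>f. f \<in> \<rho> \<and> weyl_fixed \<Phi> f \<and> f \<noteq> (\<lambda>_. 0)"
    using assms by (auto simp: Unr_def unramified_def weyl_fixed_def)
  from someI_ex[OF this]
  show "sph \<rho> \<in> \<rho>" "weyl_fixed \<Phi> (sph \<rho>)" "sph \<rho> \<noteq> (\<lambda>_. 0)" unfolding sph_def by blast+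
qed

lemma sph_L2: "\<rho> \<in> Unr \<Longrightarrow> sph \<rho> \<in> L2 \<Phi> \<Gamma>"
  using sph(1)[of \<rho>] D_subrep[of \<rho>] Unr_subset unfolding subrep_def by blast

lemma sph_spans:
  assumes "\<rho> \<in> Unr" "f \<in> \<rho>" "weyl_fixed \<Phi> f"
  shows "\<exists>c. f = (\<lambda>g. c * sph \<rho> g)"
proof -
  obtain \<theta> where "induced_embedding \<Phi> (\<xi> \<rho>) (L2 \<Phi> \<Gamma>) \<rho> \<theta>"
    using has_character_embedding[OF Unr_character[OF assms(1)] D_subrep] assms(1) Unr_subset by auto
  then interpret induced_embedding \<Phi> "\<xi> \<rho>" "L2 \<Phi> \<Gamma>" \<rho> \<theta> .
  show ?thesis by (rule weyl_fixed_unique[OF sph[OF assms(1)] assms(2,3)])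
qed

lemma sph_eigenvector:
  assumes "\<rho> \<in> Unr" "weyl_stable \<Phi> M"
  shows "translation_sum M (sph \<rho>) = (\<lambda>g. (\<Sum>l\<in>#M. \<xi> \<rho> l) * sph \<rho> g)"
proof -
  obtain \<theta> where "induced_embedding \<Phi> (\<xi> \<rho>) (L2 \<Phi> \<Gamma>) \<rho> \<theta>"
    using has_character_embedding[OF Unr_character[OF assms(1)] D_subrep] assms(1) Unr_subset by auto
  then interpret induced_embedding \<Phi> "\<xi> \<rho>" "L2 \<Phi> \<Gamma>" \<rho> \<theta> .
  show ?thesis by (rule translation_sum_eigenvector[OF sph(1,2)[OF assms(1)] assms(2)])
qed

text \<open>The family \<open>c\<close> consists of the components of \<open>f\<close> in the direct sum decomposition \<open>D\<close>.\<close>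

definition components ::
  "((('a \<Rightarrow> 'a) \<Rightarrow> complex) set \<Rightarrow> ('a \<Rightarrow> 'a) \<Rightarrow> complex) \<Rightarrow> (('a \<Rightarrow> 'a) \<Rightarrow> complex) \<Rightarrow> bool" where
  "components c f \<longleftrightarrow> (\<forall>U\<in>D. c U \<in> U) \<and> (\<forall>U. U \<notin> D \<longrightarrow> c U = (\<lambda>_. 0)) \<and>
     f = (\<lambda>g. \<Sum>U\<in>D. c U g)"

lemma components_ex: "f \<in> L2 \<Phi> \<Gamma> \<Longrightarrow> \<exists>c. components c f"
  and components_unique: "f \<in> L2 \<Phi> \<Gamma> \<Longrightarrow> components c f \<Longrightarrow> components c' f \<Longrightarrow> c = c'"
proof -
  have ex1: "\<exists>!c. components c f" if "f \<in> L2 \<Phi> \<Gamma>" for f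
    using decomposition that unfolding irr_decomposition_def components_def by blast
  show "f \<in> L2 \<Phi> \<Gamma> \<Longrightarrow> \<exists>c. components c f" using ex1 by (rule ex1_implies_ex)
  show "f \<in> L2 \<Phi> \<Gamma> \<Longrightarrow> components c f \<Longrightarrow> components c' f \<Longrightarrow> c = c'"
    using ex1[of f] by blast
qed

text \<open>
  By uniqueness the components of a Weyl-fixed vector are Weyl-fixed. Hence they vanish on the ramified
  constituents and are multiples of the spherical vectors on the others.
\<close>

lemma sph_expansion:
  assumes f: "f \<in> L2 \<Phi> \<Gamma>" "weyl_fixed \<Phi> f"
  shows "\<exists>b. f = (\<lambda>g. \<Sum>\<rho>\<in>Unr. b \<rho> * sph \<rho> g)"
proof -
  obtain c where c: "components c f" using components_ex[OF f(1)] by blast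
  have cD: "c U \<in> U" if "U \<in> D" for U using c that by (simp add: components_def)
  have fixed: "weyl_fixed \<Phi> (c U)" for U
    unfolding weyl_fixed_def
  proof
    fix w assume w: "w \<in> W"
    have wW: "w \<in> Wext" using weyl_subset_Wext w by blast
    have "components (\<lambda>U. rtrans w (c U)) f"
      unfolding components_def
    proof (intro conjI ballI allI impI ext)
      fix U assume U: "U \<in> D"
      show "rtrans w (c U) \<in> U" using D_subrep[OF U] cD[OF U] wW by (simp add: subrep_def)
    next
      fix U g assume "U \<notin> D"
      then show "rtrans w (c U) g = 0" using c by (simp add: components_def rtrans_def)
    next
      fix g
      have "f g = f (g \<circ> w)" using weyl_fixedD[OF f(2) w] by simp
      also have "\<dots> = (\<Sum>U\<in>D. rtrans w (c U) g)" using c by (simp add: components_def rtrans_def)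
      finally show "f g = (\<Sum>U\<in>D. rtrans w (c U) g)" .
    qed
    then have "(\<lambda>U. rtrans w (c U)) = c" using components_unique[OF f(1)] c by blast
    then show "rtrans w (c U) = c U" by (rule fun_cong)
  qed
  have zero: "c U = (\<lambda>_. 0)" if "U \<in> D - Unr" for U
    using that cD fixed[of U] by (auto simp: Unr_def unramified_def weyl_fixed_def)
  have "\<forall>\<rho>\<in>Unr. \<exists>b. c \<rho> = (\<lambda>g. b * sph \<rho> g)"
    using sph_spans cD fixed Unr_subset by blast
  then obtain b where b: "\<And>\<rho>. \<rho> \<in> Unr \<Longrightarrow> c \<rho> = (\<lambda>g. b \<rho> * sph \<rho> g)" by metis
  have "f g = (\<Sum>\<rho>\<in>Unr. b \<rho> * sph \<rho> g)" for g
  proof -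
    have "f g = (\<Sum>U\<in>D. c U g)" using c by (simp add: components_def)
    also have "\<dots> = (\<Sum>U\<in>Unr. c U g)"
      using zero Unr_subset finite_D by (intro sum.mono_neutral_right) auto
    also have "\<dots> = (\<Sum>\<rho>\<in>Unr. b \<rho> * sph \<rho> g)" using b by (intro sum.cong) auto
    finally show ?thesis .
  qed
  then show ?thesis by blast
qed

lemma sph_independent:
  assumes "\<And>g. (\<Sum>\<rho>\<in>Unr. b \<rho> * sph \<rho> g) = 0" and \<rho>: "\<rho> \<in> Unr"
  shows "b \<rho> = 0"
proof -
  let ?z = "\<lambda>_::'a \<Rightarrow> 'a. 0::complex"
  let ?c = "\<lambda>U. if U \<in> Unr then (\<lambda>g. b U * sph U g) else ?z"
  have z: "?z \<in> L2 \<Phi> \<Gamma>" by (simp add: L2_def)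
  have zU: "?z \<in> U" if "U \<in> D" for U using D_subrep[OF that] by (simp add: subrep_def)
  have "components (\<lambda>_. ?z) ?z" using zU by (simp add: components_def)
  moreover have "components ?c ?z"
    unfolding components_def
  proof (intro conjI ballI allI impI ext)
    fix U assume U: "U \<in> D"
    show "?c U \<in> U" using zU[OF U] subrep_scale[OF D_subrep[OF U]] sph(1)[of U] by simp
  next
    fix g
    have "(\<Sum>U\<in>D. ?c U g) = (\<Sum>U\<in>Unr. ?c U g)"
      using Unr_subset finite_D by (intro sum.mono_neutral_right) auto
    also have "\<dots> = (\<Sum>U\<in>Unr. b U * sph U g)" by (intro sum.cong) auto
    finally show "0 = (\<Sum>U\<in>D. ?c U g)" using assms(1) by simp
  qed (use Unr_subset in auto)
  ultimately have eq: "?c = (\<lambda>_. ?z)" using components_unique[OF z] by blast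
  obtain g where g: "sph \<rho> g \<noteq> 0" using sph(3)[OF \<rho>] by blast
  have "?c \<rho> g = 0" using fun_cong[OF fun_cong[OF eq, of \<rho>], of g] .
  then show ?thesis using g \<rho> by simp
qed

text \<open>
  The indicator function of the double coset in \<open>\<Gamma> \ W\<^sub>e\<^sub>x\<^sub>t / W\<close> of the translation by \<open>x\<close>. An element
  \<open>g\<close> is in it if and only if the vertex \<open>g 0\<close> lies in the \<open>\<Gamma>\<close>-orbit of \<open>x\<close>.
\<close>

definition ind_orbit :: "'a \<Rightarrow> ('a \<Rightarrow> 'a) \<Rightarrow> complex" where
  "ind_orbit x g = of_bool (g \<in> Wext \<and> (\<exists>\<gamma>\<in>\<Gamma>. \<gamma> x = g 0))"

lemma ind_orbit_L2: "ind_orbit x \<in> L2 \<Phi> \<Gamma>"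
  unfolding L2_def
proof (intro CollectI conjI allI impI ballI)
  fix \<gamma> g assume \<gamma>: "\<gamma> \<in> \<Gamma>" and g: "g \<in> Wext"
  obtain \<gamma>' where \<gamma>': "\<gamma>' \<in> \<Gamma>" "\<gamma>' \<circ> \<gamma> = id" using Gamma_inverse \<gamma> by blast
  have "(\<exists>\<delta>\<in>\<Gamma>. \<delta> x = \<gamma> (g 0)) \<longleftrightarrow> (\<exists>\<delta>\<in>\<Gamma>. \<delta> x = g 0)"
  proof
    assume "\<exists>\<delta>\<in>\<Gamma>. \<delta> x = \<gamma> (g 0)"
    then obtain \<delta> where \<delta>: "\<delta> \<in> \<Gamma>" "\<delta> x = \<gamma> (g 0)" by blast
    have "(\<gamma>' \<circ> \<delta>) x = g 0" using \<delta>(2) fun_cong[OF \<gamma>'(2), of "g 0"] by simp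
    then show "\<exists>\<delta>\<in>\<Gamma>. \<delta> x = g 0" using Gamma_comp[OF \<gamma>'(1) \<delta>(1)] by blast
  next
    assume "\<exists>\<delta>\<in>\<Gamma>. \<delta> x = g 0"
    then obtain \<delta> where \<delta>: "\<delta> \<in> \<Gamma>" "\<delta> x = g 0" by blast
    then have "(\<gamma> \<circ> \<delta>) x = \<gamma> (g 0)" by simp
    then show "\<exists>\<delta>\<in>\<Gamma>. \<delta> x = \<gamma> (g 0)" using Gamma_comp[OF \<gamma> \<delta>(1)] by blast
  qed
  moreover have "\<gamma> \<circ> g \<in> Wext" using Wext_comp[OF subsetD[OF Gamma_subset_Wext \<gamma>] g] .
  ultimately show "ind_orbit x (\<gamma> \<circ> g) = ind_orbit x g" using g by (simp add: ind_orbit_def)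
qed (simp add: ind_orbit_def)

lemma ind_orbit_fixed: "weyl_fixed \<Phi> (ind_orbit x)"
  unfolding weyl_fixed_def
  by (intro ballI ext) (simp add: rtrans_def ind_orbit_def Wext_comp_weyl_iff)

lemma Wext_eq_comp_weyl:
  assumes "g \<in> Wext" "h \<in> Wext" "g 0 = h 0"
  shows "\<exists>w\<in>W. g = h \<circ> w"
proof -
  obtain w l where g: "w \<in> W" "g = transl l \<circ> w" by (rule Wext_E[OF assms(1)])
  obtain v m where h: "v \<in> W" "h = transl m \<circ> v" by (rule Wext_E[OF assms(2)])
  obtain v' where v': "v' \<in> W" "v \<circ> v' = id" using weyl_inverse[OF h(1)] by blast
  have "l = m" using assms(3) g h by simp
  then have "h \<circ> (v' \<circ> w) = transl l \<circ> ((v \<circ> v') \<circ> w)" by (simp only: h(2) comp_assoc)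
  then have "g = h \<circ> (v' \<circ> w)" by (simp only: v'(2) id_comp g(2))
  then show ?thesis using weyl_comp[OF v'(1) g(1)] by blast
qed

lemma L2_fixed_expansion:
  assumes f: "f \<in> L2 \<Phi> \<Gamma>" "weyl_fixed \<Phi> f"
  shows "f g = (\<Sum>x\<in>S. f (transl x) * ind_orbit x g)"
proof (cases "g \<in> Wext")
  case True
  have "g 0 \<in> coweights" using Wext_coweights[OF True coweights_zero] .
  then obtain x \<gamma> where x: "x \<in> S" "\<gamma> \<in> \<Gamma>" "\<gamma> x = g 0" by (rule S_representative)
  have tx: "transl x \<in> Wext" by (rule transl_in_Wext[OF S_coweights[OF x(1)]])
  have "\<gamma> \<circ> transl x \<in> Wext" by (rule Wext_comp[OF subsetD[OF Gamma_subset_Wext x(2)] tx])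
  then obtain w where w: "w \<in> W" "g = \<gamma> \<circ> transl x \<circ> w"
    using Wext_eq_comp_weyl[OF True, of "\<gamma> \<circ> transl x"] x(3) by auto
  have "f g = f (\<gamma> \<circ> transl x)" unfolding w(2) by (rule weyl_fixedD[OF f(2) w(1)])
  also have "\<dots> = f (transl x)" using f(1) x(2) tx by (simp add: L2_def)
  finally have fx: "f g = f (transl x)" .
  have "ind_orbit y g = of_bool (y = x)" if y: "y \<in> S" for y
  proof -
    have "y = x" if "\<delta> \<in> \<Gamma>" "\<delta> y = g 0" for \<delta>
    proof -
      obtain \<gamma>' where \<gamma>': "\<gamma>' \<in> \<Gamma>" "\<gamma>' \<circ> \<gamma> = id" using Gamma_inverse x(2) by blast
      have "(\<gamma>' \<circ> \<delta>) y = x" using that(2) x(3) fun_cong[OF \<gamma>'(2), of x] by simp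
      then show ?thesis using S_unique[OF y x(1) Gamma_comp[OF \<gamma>'(1) that(1)]] by blast
    qed
    then have "(\<exists>\<delta>\<in>\<Gamma>. \<delta> y = g 0) \<longleftrightarrow> y = x" using x(2,3) by blast
    then show ?thesis using True by (simp add: ind_orbit_def)
  qed
  then have "(\<Sum>y\<in>S. f (transl y) * ind_orbit y g) = (\<Sum>y\<in>S. if y = x then f (transl x) else 0)"
    by (intro sum.cong) auto
  also have "\<dots> = f (transl x)" using finite_S x(1) by simp
  finally show ?thesis using fx by simp
next
  case False
  then show ?thesis using f(1) by (simp add: L2_def ind_orbit_def)
qed

text \<open>
  The trace of a translation operator on the Weyl-fixed vectors of \<open>L2\<close>, computed in the basis of
  indicator functions on the left and in the basis of eigenvectors \<open>sph \<rho>\<close> on the right.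
\<close>

lemma trace_formula:
  assumes M: "weyl_stable \<Phi> M"
  shows "(\<Sum>x\<in>S. translation_sum M (ind_orbit x) (transl x)) = (\<Sum>\<rho>\<in>Unr. \<Sum>l\<in>#M. \<xi> \<rho> l)"
proof -
  let ?ev = "\<lambda>\<rho>. \<Sum>l\<in>#M. \<xi> \<rho> l"
  have "\<forall>x. \<exists>b. ind_orbit x = (\<lambda>g. \<Sum>\<rho>\<in>Unr. b \<rho> * sph \<rho> g)"
    using sph_expansion[OF ind_orbit_L2 ind_orbit_fixed] by blast
  then obtain b where b: "\<And>x. ind_orbit x = (\<lambda>g. \<Sum>\<rho>\<in>Unr. b x \<rho> * sph \<rho> g)" by metis
  have A: "translation_sum M (ind_orbit x) g = (\<Sum>\<rho>\<in>Unr. b x \<rho> * (?ev \<rho> * sph \<rho> g))" for x g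
  proof -
    have "translation_sum M (ind_orbit x) g = (\<Sum>\<rho>\<in>Unr. b x \<rho> * translation_sum M (sph \<rho>) g)"
      by (simp add: b translation_sum_def sum_mset_sum_swap sum_mset_distrib_left)
    also have "\<dots> = (\<Sum>\<rho>\<in>Unr. b x \<rho> * (?ev \<rho> * sph \<rho> g))"
      using sph_eigenvector[OF _ M] by (intro sum.cong) auto
    finally show ?thesis .
  qed
  \<comment> \<open>The matrices of the two base changes are inverse to each other; only the diagonal matters.\<close>
  have dual: "(\<Sum>x\<in>S. sph \<rho> (transl x) * b x \<rho>) = 1" if \<rho>: "\<rho> \<in> Unr" for \<rho>
  proof -
    let ?c = "\<lambda>\<sigma>. \<Sum>x\<in>S. sph \<rho> (transl x) * b x \<sigma>"
    have "(\<Sum>\<sigma>\<in>Unr. (?c \<sigma> - of_bool (\<sigma> = \<rho>)) * sph \<sigma> g) = 0" for g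
    proof -
      have "(\<Sum>\<sigma>\<in>Unr. ?c \<sigma> * sph \<sigma> g) = (\<Sum>x\<in>S. \<Sum>\<sigma>\<in>Unr. sph \<rho> (transl x) * b x \<sigma> * sph \<sigma> g)"
        unfolding sum_distrib_right by (rule sum.swap)
      also have "\<dots> = (\<Sum>x\<in>S. sph \<rho> (transl x) * ind_orbit x g)"
        by (simp add: b sum_distrib_left mult.assoc)
      also have "\<dots> = sph \<rho> g" by (rule L2_fixed_expansion[OF sph_L2[OF \<rho>] sph(2)[OF \<rho>], symmetric])
      finally have 1: "(\<Sum>\<sigma>\<in>Unr. ?c \<sigma> * sph \<sigma> g) = sph \<rho> g" .
      have "(\<Sum>\<sigma>\<in>Unr. of_bool (\<sigma> = \<rho>) * sph \<sigma> g) = (\<Sum>\<sigma>\<in>Unr. if \<sigma> = \<rho> then sph \<rho> g else 0)"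
        by (intro sum.cong) auto
      also have "\<dots> = sph \<rho> g" using finite_Unr \<rho> by simp
      finally show ?thesis using 1 by (simp add: left_diff_distrib sum_subtractf)
    qed
    then have "?c \<rho> - of_bool (\<rho> = \<rho>) = 0"
      using sph_independent[of "\<lambda>\<sigma>. ?c \<sigma> - of_bool (\<sigma> = \<rho>)", OF _ \<rho>] by blast
    then show ?thesis by simp
  qed
  have "(\<Sum>x\<in>S. translation_sum M (ind_orbit x) (transl x))
      = (\<Sum>\<rho>\<in>Unr. \<Sum>x\<in>S. b x \<rho> * (?ev \<rho> * sph \<rho> (transl x)))"
    unfolding A by (rule sum.swap)
  also have "\<dots> = (\<Sum>\<rho>\<in>Unr. ?ev \<rho> * (\<Sum>x\<in>S. sph \<rho> (transl x) * b x \<rho>))"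
    by (simp add: sum_distrib_left mult_ac)
  also have "\<dots> = (\<Sum>\<rho>\<in>Unr. ?ev \<rho>)" using dual by (intro sum.cong) auto
  finally show ?thesis .
qed

lemma translation_sum_ind_orbit:
  assumes "x \<in> coweights" "set_mset M \<subseteq> coweights"
  shows "translation_sum M (ind_orbit x) (transl x) = (\<Sum>l\<in>#M. of_bool (\<exists>\<gamma>\<in>\<Gamma>. \<gamma> x = x + l))"
proof -
  have "ind_orbit x (transl x \<circ> transl l) = of_bool (\<exists>\<gamma>\<in>\<Gamma>. \<gamma> x = x + l)" if "l \<in># M" for l
    using Wext_comp_transl_iff[of l "transl x"] transl_in_Wext[OF assms(1)] assms(2) that
    by (simp add: ind_orbit_def subset_iff add.commute)
  then show ?thesis unfolding translation_sum_def
    by (intro arg_cong[of _ _ sum_mset] image_mset_cong)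
qed

text \<open>The trace of the identity operator, which is the sum over the translation by \<open>0\<close> alone.\<close>

lemma card_Unr: "card Unr = card S"
proof -
  have "weyl_stable \<Phi> {#0#}" by (simp add: weyl_stable_def)
  then have "(\<Sum>x\<in>S. translation_sum {#0#} (ind_orbit x) (transl x)) = (\<Sum>\<rho>\<in>Unr. \<xi> \<rho> 0)"
    using trace_formula[of "{#0#}"] by simp
  also have "\<dots> = (\<Sum>\<rho>\<in>Unr. 1)"
    using character_zero Unr_character by (intro sum.cong) (auto simp: has_character_def)
  finally have 1: "(\<Sum>x\<in>S. translation_sum {#0#} (ind_orbit x) (transl x)) = of_nat (card Unr)" by simp
  have "(\<Sum>x\<in>S. translation_sum {#0#} (ind_orbit x) (transl x)) = (\<Sum>x\<in>S. 1)"
  proof (rule sum.cong)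
    fix x assume "x \<in> S"
    moreover have "\<exists>\<gamma>\<in>\<Gamma>. \<gamma> x = x" using Gamma_id by (intro bexI[of _ id]) auto
    ultimately show "translation_sum {#0#} (ind_orbit x) (transl x) = 1"
      by (simp add: translation_sum_ind_orbit S_coweights)
  qed simp
  then have "(of_nat (card Unr) :: complex) = of_nat (card S)" using 1 by simp
  then show ?thesis by (simp only: of_nat_eq_iff)
qed

lemma card_double_cosets: "card (double_cosets \<Gamma> Wext W) = card S"
proof -
  let ?d = "\<lambda>g. {h \<circ> g \<circ> k | h k. h \<in> \<Gamma> \<and> k \<in> W}"
  have sub: "?d (h \<circ> g \<circ> k) \<subseteq> ?d g" if "h \<in> \<Gamma>" "k \<in> W" for g h k
  proof clarify
    fix h' k' assume *: "h' \<in> \<Gamma>" "k' \<in> W"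
    show "\<exists>h'' k''. h' \<circ> (h \<circ> g \<circ> k) \<circ> k' = h'' \<circ> g \<circ> k'' \<and> h'' \<in> \<Gamma> \<and> k'' \<in> W"
      using Gamma_comp[OF *(1) that(1)] weyl_comp[OF that(2) *(2)]
      by (intro exI[of _ "h' \<circ> h"] exI[of _ "k \<circ> k'"]) (simp add: comp_assoc)
  qed
  have eq: "?d (h \<circ> g \<circ> k) = ?d g" if hk: "h \<in> \<Gamma>" "k \<in> W" for g h k
  proof
    obtain h' where h': "h' \<in> \<Gamma>" "h' \<circ> h = id" using Gamma_inverse hk by blast
    obtain k' where k': "k' \<in> W" "k \<circ> k' = id" using weyl_inverse hk by blast
    have "h' \<circ> (h \<circ> g \<circ> k) \<circ> k' = (h' \<circ> h) \<circ> g \<circ> (k \<circ> k')" by (simp only: comp_assoc)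
    then have "h' \<circ> (h \<circ> g \<circ> k) \<circ> k' = g" by (simp only: h'(2) k'(2) id_comp comp_id)
    then show "?d g \<subseteq> ?d (h \<circ> g \<circ> k)" using sub[OF h'(1) k'(1), of "h \<circ> g \<circ> k"] by simp
  qed (rule sub[OF hk])
  have inj: "inj_on (\<lambda>x. ?d (transl x)) S"
  proof (rule inj_onI)
    fix x y assume xy: "x \<in> S" "y \<in> S" "?d (transl x) = ?d (transl y)"
    have "id \<circ> transl y \<circ> id \<in> ?d (transl y)" using Gamma_id weyl.id by blast
    then have "transl y \<in> ?d (transl x)" unfolding xy(3) by simp
    then obtain h k where hk: "h \<in> \<Gamma>" "k \<in> W" "transl y = h \<circ> transl x \<circ> k" by blast
    have "h x = y" using fun_cong[OF hk(3), of 0] hk(2) by simp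
    then show "x = y" by (rule S_unique[OF xy(1,2) hk(1)])
  qed
  have "(\<lambda>x. ?d (transl x)) ` S = ?d ` Wext"
  proof
    show "(\<lambda>x. ?d (transl x)) ` S \<subseteq> ?d ` Wext" using transl_in_Wext S_coweights by blast
    show "?d ` Wext \<subseteq> (\<lambda>x. ?d (transl x)) ` S"
    proof (rule image_subsetI)
      fix g assume g: "g \<in> Wext"
      obtain x \<gamma> where x: "x \<in> S" "\<gamma> \<in> \<Gamma>" "\<gamma> x = g 0"
        by (rule S_representative[OF Wext_coweights[OF g coweights_zero]])
      have "\<gamma> \<circ> transl x \<in> Wext"
        by (rule Wext_comp[OF subsetD[OF Gamma_subset_Wext x(2)] transl_in_Wext[OF S_coweights[OF x(1)]]])
      then obtain w where w: "w \<in> W" "g = \<gamma> \<circ> transl x \<circ> w"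
        using Wext_eq_comp_weyl[OF g, of "\<gamma> \<circ> transl x"] x(3) by auto
      show "?d g \<in> (\<lambda>x. ?d (transl x)) ` S"
        using eq[OF x(2) w(1), of "transl x"] x(1) unfolding w(2) by (rule image_eqI)
    qed
  qed
  then show ?thesis unfolding double_cosets_def using card_image[OF inj] by simp
qed

text \<open>Since \<open>\<Gamma>\<close> acts freely, a closed walk is determined by its starting point and its direction.\<close>

lemma count_translates:
  "(\<Sum>\<^sub>\<infinity>\<gamma>\<in>\<Gamma>. real (card {x\<in>S. \<gamma> x = x + l})) = (\<Sum>x\<in>S. of_bool (\<exists>\<gamma>\<in>\<Gamma>. \<gamma> x = x + l))"
proof -
  define A where "A = {\<gamma>\<in>\<Gamma>. \<exists>x\<in>S. \<gamma> x = x + l}"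
  have "finite (\<Union>x\<in>S. {\<gamma>\<in>\<Gamma>. \<gamma> x = x + l})"
  proof (intro finite_UN_I finite_S)
    fix x
    show "finite {\<gamma>\<in>\<Gamma>. \<gamma> x = x + l}"
    proof (cases "\<exists>\<gamma>\<in>\<Gamma>. \<gamma> x = x + l")
      case True
      then obtain \<gamma> where \<gamma>: "\<gamma> \<in> \<Gamma>" "\<gamma> x = x + l" by blast
      have "\<delta> = \<gamma>" if "\<delta> \<in> \<Gamma>" "\<delta> x = x + l" for \<delta>
        by (rule Gamma_free[OF that(1) \<gamma>(1), of x]) (simp only: that(2) \<gamma>(2))
      then have "{\<gamma>\<in>\<Gamma>. \<gamma> x = x + l} \<subseteq> {\<gamma>}" by blast
      then show ?thesis using finite_subset by blast
    next
      case False
      then have "{\<gamma>\<in>\<Gamma>. \<gamma> x = x + l} = {}" by blast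
      then show ?thesis by (simp only: finite.emptyI)
    qed
  qed
  then have fin: "finite A" by (rule finite_subset[rotated]) (auto simp: A_def)
  have "(\<Sum>\<^sub>\<infinity>\<gamma>\<in>\<Gamma>. real (card {x\<in>S. \<gamma> x = x + l})) = (\<Sum>\<^sub>\<infinity>\<gamma>\<in>A. real (card {x\<in>S. \<gamma> x = x + l}))"
    by (rule infsum_cong_neutral) (auto simp: A_def card_eq_0_iff)
  also have "\<dots> = (\<Sum>\<gamma>\<in>A. real (card {x\<in>S. \<gamma> x = x + l}))" using fin by simp
  also have "\<dots> = (\<Sum>\<gamma>\<in>A. \<Sum>x\<in>S. of_bool (\<gamma> x = x + l))"
    using finite_S by (intro sum.cong) (simp_all add: Int_def conj_commute)
  also have "\<dots> = (\<Sum>x\<in>S. \<Sum>\<gamma>\<in>A. of_bool (\<gamma> x = x + l))" by (rule sum.swap)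
  also have "\<dots> = (\<Sum>x\<in>S. of_bool (\<exists>\<gamma>\<in>\<Gamma>. \<gamma> x = x + l))"
  proof (rule sum.cong)
    fix x assume x: "x \<in> S"
    show "(\<Sum>\<gamma>\<in>A. of_bool (\<gamma> x = x + l) :: real) = of_bool (\<exists>\<gamma>\<in>\<Gamma>. \<gamma> x = x + l)"
    proof (cases "\<exists>\<gamma>\<in>\<Gamma>. \<gamma> x = x + l")
      case True
      then obtain \<gamma> where \<gamma>: "\<gamma> \<in> \<Gamma>" "\<gamma> x = x + l" by blast
      have \<gamma>A: "\<gamma> \<in> A" using \<gamma> x by (auto simp: A_def)
      have "\<delta> x = x + l \<longleftrightarrow> \<delta> = \<gamma>" if "\<delta> \<in> A" for \<delta>
        using Gamma_free[of \<delta> \<gamma> x] \<gamma> that by (auto simp: A_def)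
      then have "(\<Sum>\<delta>\<in>A. of_bool (\<delta> x = x + l) :: real) = (\<Sum>\<delta>\<in>A. if \<delta> = \<gamma> then 1 else 0)"
        by (intro sum.cong) auto
      then show ?thesis using True fin \<gamma>A by simp
    next
      case False
      then have "of_bool (\<gamma> x = x + l) = (0::real)" if "\<gamma> \<in> A" for \<gamma>
        using that by (auto simp: A_def)
      then show ?thesis using False by simp
    qed
  qed simp
  finally show ?thesis .
qed

lemma closed_walks_eq_character_sum:
  assumes M: "weyl_stable \<Phi> M"
  shows "complex_of_real (closed_walks \<Gamma> S M n) = (\<Sum>\<rho>\<in>Unr. \<Sum>l\<in>#M. \<xi> \<rho> l ^ n)"
proof -
  let ?Mn = "image_mset (\<lambda>l. real n *\<^sub>R l) M"
  have Mn: "weyl_stable \<Phi> ?Mn" by (rule weyl_stable_scale[OF M])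
  have "closed_walks \<Gamma> S M n = (\<Sum>x\<in>S. \<Sum>l\<in>#M. of_bool (\<exists>\<gamma>\<in>\<Gamma>. \<gamma> x = x + real n *\<^sub>R l))"
    unfolding closed_walks_def count_translates by (rule sum_mset_sum_swap)
  also have "complex_of_real \<dots> = (\<Sum>x\<in>S. \<Sum>l\<in>#?Mn. of_bool (\<exists>\<gamma>\<in>\<Gamma>. \<gamma> x = x + l))"
  proof -
    have "complex_of_real (\<Sum>l\<in>#M. of_bool (P l)) = (\<Sum>l\<in>#M. of_bool (P l))" for P
      by (induction M) auto
    then show ?thesis by (simp add: multiset.map_comp comp_def)
  qed
  also have "\<dots> = (\<Sum>x\<in>S. translation_sum ?Mn (ind_orbit x) (transl x))"
    using Mn translation_sum_ind_orbit[OF S_coweights, of _ ?Mn]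
    by (intro sum.cong) (auto simp: weyl_stable_def)
  also have "\<dots> = (\<Sum>\<rho>\<in>Unr. \<Sum>l\<in>#?Mn. \<xi> \<rho> l)" by (rule trace_formula[OF Mn])
  also have "\<dots> = (\<Sum>\<rho>\<in>Unr. \<Sum>l\<in>#M. \<xi> \<rho> l ^ n)"
  proof (rule sum.cong)
    fix \<rho> assume "\<rho> \<in> Unr"
    then have "lattice_character coweights (\<xi> \<rho>)" using Unr_character by (simp add: has_character_def)
    then have "\<xi> \<rho> (real n *\<^sub>R l) = \<xi> \<rho> l ^ n" if "l \<in># M" for l
      using character_nat that M by (auto simp: weyl_stable_def)
    then show "(\<Sum>l\<in>#?Mn. \<xi> \<rho> l) = (\<Sum>l\<in>#M. \<xi> \<rho> l ^ n)"
      by (auto simp: multiset.map_comp comp_def intro!: arg_cong[of _ _ sum_mset] image_mset_cong)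
  qed simp
  finally show ?thesis .
qed

end

section \<open>The generating function of the power sums\<close>

lemma log_series_sums:
  fixes z :: complex
  assumes "norm z < 1"
  shows "(\<lambda>n. z ^ Suc n / of_nat (Suc n)) sums - Ln (1 - z)"
proof -
  have "(\<lambda>n. - ((- (- z)) ^ n) / of_nat n) sums Ln (1 + - z)" using assms by (intro Ln_series') simp
  then have "(\<lambda>n. z ^ n / of_nat n) sums - Ln (1 - z)"
    using sums_minus[of "\<lambda>n. - (z ^ n) / of_nat n" "Ln (1 - z)"] by simp
  then show ?thesis by (subst sums_Suc_iff) simp
qed

lemma exp_minus_Ln: "norm z < 1 \<Longrightarrow> exp (- Ln (1 - z)) = inverse (1 - z)" for z :: complex
  by (subst exp_minus, subst exp_Ln) auto

lemma sums_sum_mset: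
  fixes f :: "'b \<Rightarrow> nat \<Rightarrow> complex"
  shows "(\<And>l. l \<in># M \<Longrightarrow> f l sums s l) \<Longrightarrow> (\<lambda>n. \<Sum>l\<in>#M. f l n) sums (\<Sum>l\<in>#M. s l)"
  by (induction M) (simp_all add: sums_add)

lemma exp_sum_mset: "exp (\<Sum>l\<in>#M. s l) = (\<Prod>l\<in>#M. exp (s l))" for s :: "'b \<Rightarrow> complex"
  by (induction M) (simp_all add: exp_add)

text \<open>
  If \<open>p\<^sub>n\<close> is the sum of the \<open>n\<close>-th powers of finitely many numbers \<open>z\<close>, then the exponential of the
  sum of \<open>p\<^sub>n u\<^sup>n / n\<close> is the product of \<open>1 / (1 - z u)\<close>.
\<close>

lemma power_sums_generating_function:
  fixes z :: "'i \<Rightarrow> 'b \<Rightarrow> complex" and u :: complex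
  assumes I: "finite I" and z: "\<And>i l. i \<in> I \<Longrightarrow> l \<in># M \<Longrightarrow> norm (z i l * u) < 1"
  shows "summable (\<lambda>n. (\<Sum>i\<in>I. \<Sum>l\<in>#M. z i l ^ Suc n) / of_nat (Suc n) * u ^ Suc n)" (is "summable ?a")
    and "exp (\<Sum>n. (\<Sum>i\<in>I. \<Sum>l\<in>#M. z i l ^ Suc n) / of_nat (Suc n) * u ^ Suc n) =
      (\<Prod>i\<in>I. \<Prod>l\<in>#M. inverse (1 - z i l * u))"
proof -
  let ?s = "\<Sum>i\<in>I. \<Sum>l\<in>#M. - Ln (1 - z i l * u)"
  have a: "?a = (\<lambda>n. \<Sum>i\<in>I. \<Sum>l\<in>#M. (z i l * u) ^ Suc n / of_nat (Suc n))"
  proof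
    fix n
    have "c * (\<Sum>l\<in>#M. f l) * d = (\<Sum>l\<in>#M. c * f l * d)" for c d :: complex and f
      by (induction M) (simp_all add: algebra_simps)
    from this[of "1 / of_nat (Suc n)" _ "u ^ Suc n"]
    show "?a n = (\<Sum>i\<in>I. \<Sum>l\<in>#M. (z i l * u) ^ Suc n / of_nat (Suc n))"
      by (simp add: sum_divide_distrib sum_distrib_right power_mult_distrib del: power_Suc of_nat_Suc)
  qed
  have "?a sums ?s" unfolding a
    by (intro sums_sum sums_sum_mset log_series_sums z)
  then show "summable ?a" and "exp (suminf ?a) = (\<Prod>i\<in>I. \<Prod>l\<in>#M. inverse (1 - z i l * u))"
  proof -
    assume s: "?a sums ?s"
    show "summable ?a" using s by (rule sums_summable)
    have "exp (suminf ?a) = (\<Prod>i\<in>I. \<Prod>l\<in>#M. exp (- Ln (1 - z i l * u)))"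
      unfolding sums_unique[OF s, symmetric] by (simp only: exp_sum[OF I] exp_sum_mset)
    also have "\<dots> = (\<Prod>i\<in>I. \<Prod>l\<in>#M. inverse (1 - z i l * u))"
      using z exp_minus_Ln by (intro prod.cong refl arg_cong[of _ _ prod_mset] image_mset_cong) auto
    finally show "exp (suminf ?a) = (\<Prod>i\<in>I. \<Prod>l\<in>#M. inverse (1 - z i l * u))" .
  qed
qed

section \<open>The L-function\<close>

theorem theorem3p2:
  fixes v :: "'f::field \<Rightarrow> real"
    and G T :: "('f alg_closure^'n^'n) set"
    and ch :: "'a::euclidean_space \<Rightarrow> 'f alg_closure^'n^'n \<Rightarrow> 'f alg_closure"
    and \<Phi> :: "'a set"
    and Gd Td :: "(complex^'m^'m) set"
    and chd :: "'a \<Rightarrow> complex^'m^'m \<Rightarrow> complex"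
    and \<pi> :: "complex^'m^'m \<Rightarrow> complex^'d^'d"
    and \<omega> :: "'a"
    and \<Gamma> :: "('a \<Rightarrow> 'a) set"
    and D :: "(('a \<Rightarrow> 'a) \<Rightarrow> complex) set set"
    and \<xi> :: "(('a \<Rightarrow> 'a) \<Rightarrow> complex) set \<Rightarrow> 'a \<Rightarrow> complex"
    and S :: "'a set"
    and u :: complex
  defines "Irr \<equiv> {\<rho>\<in>D. unramified \<Phi> \<rho>}"
    and "\<epsilon> \<equiv> size (wt Td chd \<Phi> \<pi> - wt' Td chd \<Phi> \<pi>)"
    and "N \<equiv> card (double_cosets \<Gamma> (ext_affine_weyl \<Phi>) (weyl \<Phi>))"
    and "Nwalks \<equiv> closed_walks \<Gamma> S (wt' Td chd \<Phi> \<pi>)"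
  assumes "nonarch_local_field v"
    and "root_system \<Phi>"
    and "split_adjoint_simple_group G T ch \<Phi>"
    and "dual_group Gd Td chd \<Phi>"
    and "irreducible_rep Gd \<pi>"
    and "dual_fundamental_weight \<Phi> \<omega>"
    and "set_mset (wt' Td chd \<Phi> \<pi>) = (\<lambda>w. w \<omega>) ` weyl \<Phi>"
    and "subgroup \<Gamma> (comp_group (affine_weyl \<Phi>))"
    and "finite_index (comp_group (affine_weyl \<Phi>)) \<Gamma>"
    and "torsion_free \<Gamma>"
    and "irr_decomposition \<Phi> (L2 \<Phi> \<Gamma>) D"
    and "\<forall>\<rho>\<in>Irr. has_character \<Phi> \<rho> (\<xi> \<rho>)"
    and "orbit_reps \<Gamma> (coweight_lattice \<Phi>) S"
    and "norm u < 1"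
  shows "summable (\<lambda>n. of_real (Nwalks (Suc n)) / of_nat (Suc n) * u ^ Suc n) \<and>
         L_function Irr \<xi> (wt Td chd \<Phi> \<pi>) u =
           (1 - u) powi (- int (\<epsilon> * N)) *
           exp (\<Sum>n. of_real (Nwalks (Suc n)) / of_nat (Suc n) * u ^ Suc n)"
proof -
  interpret spectral \<Phi> \<Gamma> S D \<xi>
    using assms unfolding Irr_def
    by (intro spectral.intro affine_subgroup.intro rootsys.intro spectral_axioms.intro
        affine_subgroup_axioms.intro)
  have Irr: "Unr = Irr" by (simp add: Irr_def Unr_def)
  let ?M = "wt' Td chd \<Phi> \<pi>" and ?wt = "wt Td chd \<Phi> \<pi>"
  \<comment> \<open>There is a nonzero weight, so that the set of weights is finite and \<open>count_wt\<close> applies.\<close>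
  have "?M \<noteq> {#}"
    using \<open>set_mset ?M = (\<lambda>w. w \<omega>) ` weyl \<Phi>\<close> weyl.id by fastforce
  then have ne: "?wt \<noteq> {#}" by (auto simp: wt'_def)
  have rd: "has_root_datum Gd Td chd coweights (coroot ` \<Phi>)"
    using \<open>dual_group Gd Td chd \<Phi>\<close> by (simp add: dual_group_def)
  have hom: "\<pi> \<in> hom (as_group Gd) GL"
    using \<open>irreducible_rep Gd \<pi>\<close> by (simp add: irreducible_rep_def)
  have coweights: "l \<in> coweights" if "l \<in># ?wt" for l
    using that count_wt[OF ne, of l] by (auto simp: count_eq_zero_iff split: if_splits)
  have M: "weyl_stable \<Phi> ?M"
    using image_wt'_weyl[OF rd hom ne] coweights by (auto simp: weyl_stable_def wt'_def)
  have walks: "complex_of_real (Nwalks n) = (\<Sum>\<rho>\<in>Irr. \<Sum>l\<in>#?M. \<xi> \<rho> l ^ n)" for n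
    using closed_walks_eq_character_sum[OF M, of n] by (simp add: Nwalks_def Irr)
  have less: "norm (\<xi> \<rho> l * u) < 1" if "\<rho> \<in> Irr" "l \<in># ?M" for \<rho> l
    using Unr_norm_character[of \<rho> l] that M \<open>norm u < 1\<close>
    by (auto simp: Irr norm_mult weyl_stable_def)
  have fin: "finite Irr" using finite_Unr by (simp add: Irr)
  note gen = power_sums_generating_function[of Irr ?M \<xi> u, OF fin less]
  have N: "card Irr = N" using card_Unr card_double_cosets by (simp add: N_def Irr)
  have split: "?wt = ?M + replicate_mset \<epsilon> 0"
  proof -
    have part: "?wt = ?M + filter_mset (\<lambda>l. \<not> l \<noteq> 0) ?wt"
      unfolding wt'_def by (rule multiset_partition)
    have "filter_mset (\<lambda>l. \<not> l \<noteq> 0) ?wt = replicate_mset (count ?wt 0) 0"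
      by (rule multiset_eqI) auto
    then have 1: "?wt = ?M + replicate_mset (count ?wt 0) 0" using part by simp
    have "?wt - ?M = replicate_mset (count ?wt 0) 0"
      by (subst 1) (rule add_diff_cancel_left')
    then have "\<epsilon> = count ?wt 0" by (simp add: \<epsilon>_def)
    then show ?thesis using 1 by simp
  qed
  have "L_function Irr \<xi> ?wt u =
      (\<Prod>\<rho>\<in>Irr. inverse (1 - u) ^ \<epsilon> * (\<Prod>l\<in>#?M. inverse (1 - \<xi> \<rho> l * u)))"
    unfolding L_function_def
  proof (rule prod.cong)
    fix \<rho> assume "\<rho> \<in> Irr"
    then have "\<xi> \<rho> 0 = 1" using character_zero Unr_character[of \<rho>] by (simp add: has_character_def Irr)
    then show "(\<Prod>l\<in>#?wt. inverse (1 - \<xi> \<rho> l * u)) =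
        inverse (1 - u) ^ \<epsilon> * (\<Prod>l\<in>#?M. inverse (1 - \<xi> \<rho> l * u))"
      by (subst split) (simp add: mult.commute)
  qed simp
  also have "\<dots> = (inverse (1 - u) ^ \<epsilon>) ^ N * (\<Prod>\<rho>\<in>Irr. \<Prod>l\<in>#?M. inverse (1 - \<xi> \<rho> l * u))"
    by (simp add: prod.distrib N)
  also have "(inverse (1 - u) ^ \<epsilon>) ^ N = (1 - u) powi (- int (\<epsilon> * N))"
    by (simp only: power_int_minus power_int_of_nat power_mult power_inverse)
  finally show ?thesis using gen by (simp only: walks simp_thms)
qed

end
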